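(* Let $m=2$ and consider the primal–dual pair $(P)$: $\sup\{c_1x_1+c_2x_2 : x_1A_1+x_2A_2\preceq B\}$ and $(D)$: $\inf\{B\bullet Y : A_i\bullet Y=c_i\ (i=1,2),\ Y\succeq 0\}$, where $A_1,A_2,B\in\mathcal S^n$, $c\in\mathbb R^2$. Assume the standing assumption below. Then $\operatorname{val}(P)<\operatorname{val}(D)$ if and only if $(P)$ has a reformulation of the form $$\sup\ c_2'x_2\quad\text{s.t.}\quad x_1A_1'+x_2A_2'\preceq B'=I_r\oplus 0_{n-r},$$ where, partitioning row/column indices into consecutive blocks $\mathcal I_1,\mathcal I_2,\mathcal I_3,\mathcal I_4$ of sizes $p,\ r-p,\ s,\ n-r-s$ (with $s\ge 0$): $A_1'=\Lambda\oplus 0$ with $\Lambda\in\mathcal S^p$ diagonal and positive definite; and $A_2'$ has blocks $A_2'(\mathcal I_1,\mathcal I_1),A_2'(\mathcal I_1,\mathcal I_2),A_2'(\mathcal I_1,\mathcal I_3)$ arbitrary, $A_2'(\mathcal I_1,\mathcal I_4)=M\neq 0$, $A_2'(\mathcal I_2,\mathcal I_2)=\Sigma$ diagonal, $A_2'(\mathcal I_2,\mathcal I_3)=0$, $A_2'(\mathcal I_2,\mathcal I_4)=0$, $A_2'(\mathcal I_3,\mathcal I_3)=-I_s$, $A_2'(\mathcal I_3,\mathcal I_4)=0$, $A_2'(\mathcal I_4,\mathcal I_4)=0$ (and symmetric counterparts); and $c_2'>0$ (the coefficient of $x_1$ in the objective is $0$).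
   Context: $\mathcal S^n$ is the space of $n\times n$ real symmetric matrices; $S\preceq T$ means $T-S$ is positive semidefinite; $S\bullet T=\operatorname{trace}(ST)$; $\operatorname{val}(\cdot)$ is the optimal value (with $\sup\emptyset=-\infty$, $\inf\emptyset=+\infty$). For general $m$, $(P)$ is $\sup\{c^Tx:\sum_{i=1}^m x_iA_i\preceq B\}$ and $(D)$ is $\inf\{B\bullet Y: A_i\bullet Y=c_i\ \forall i,\ Y\succeq 0\}$. A slack of $(P)$ is a matrix $Z=B-\sum_i x_iA_i\succeq 0$. Standing assumption: $(P)$ is feasible, $A_1,\dots,A_m,B$ are linearly independent, $B=I_r\oplus 0$ for some $0\le r<n$, and $B$ is a slack of maximum rank in $(P)$. Reformulating $(P),(D)$ means applying finitely many of the operations: (1) replace $B$ by $B+\lambda A_j$ for some $j$ and $\lambda\ne0$; (2) exchange $(A_i,c_i)$ and $(A_j,c_j)$, $i\ne j$; (3) replace $(A_i,c_i)$ by $\lambda(A_i,c_i)+\mu(A_j,c_j)$ with $j\neq i$, $\lambda\neq0$; (4) replace every $A_i$ by $T^TA_iT$ and $B$ by $T^TBT$ for an invertible $T$. The result is called a reformulation. *)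

theory Defs
  imports "Jordan_Normal_Form.DL_Rank" "HOL-Library.Extended_Real"
begin

definition sym_mat :: "nat \<Rightarrow> real mat \<Rightarrow> bool" where
  "sym_mat n A \<longleftrightarrow> A \<in> carrier_mat n n \<and> transpose_mat A = A"

definition psd :: "nat \<Rightarrow> real mat \<Rightarrow> bool" where
  "psd n A \<longleftrightarrow> sym_mat n A \<and> (\<forall>v \<in> carrier_vec n. 0 \<le> scalar_prod v (A *\<^sub>v v))"

definition mat_inner :: "nat \<Rightarrow> real mat \<Rightarrow> real mat \<Rightarrow> real" where
  "mat_inner n S T = (\<Sum>i<n. (S * T) $$ (i, i))"

definition mrank :: "nat \<Rightarrow> real mat \<Rightarrow> nat" where
  "mrank n A = vec_space.rank n A"

definition slack :: "real mat \<Rightarrow> real mat \<Rightarrow> real mat \<Rightarrow> real \<Rightarrow> real \<Rightarrow> real mat" where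
  "slack A1 A2 B x1 x2 = B - x1 \<cdot>\<^sub>m A1 - x2 \<cdot>\<^sub>m A2"

definition primal_feasible :: "nat \<Rightarrow> real mat \<Rightarrow> real mat \<Rightarrow> real mat \<Rightarrow> real \<Rightarrow> real \<Rightarrow> bool" where
  "primal_feasible n A1 A2 B x1 x2 \<longleftrightarrow> psd n (slack A1 A2 B x1 x2)"

text \<open>val(P) and val(D) as extended reals (Sup {} = -inf, Inf {} = +inf).\<close>
definition valP :: "nat \<Rightarrow> real mat \<Rightarrow> real mat \<Rightarrow> real mat \<Rightarrow> real \<Rightarrow> real \<Rightarrow> ereal" where
  "valP n A1 A2 B c1 c2 =
     Sup {ereal (c1 * x1 + c2 * x2) | x1 x2. primal_feasible n A1 A2 B x1 x2}"

definition valD :: "nat \<Rightarrow> real mat \<Rightarrow> real mat \<Rightarrow> real mat \<Rightarrow> real \<Rightarrow> real \<Rightarrow> ereal" where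
  "valD n A1 A2 B c1 c2 =
     Inf {ereal (mat_inner n B Y) | Y. psd n Y \<and> mat_inner n A1 Y = c1 \<and> mat_inner n A2 Y = c2}"

definition Ir0 :: "nat \<Rightarrow> nat \<Rightarrow> real mat" where
  "Ir0 n r = mat n n (\<lambda>(i, j). if i = j \<and> i < r then 1 else 0)"

definition standing :: "nat \<Rightarrow> real mat \<Rightarrow> real mat \<Rightarrow> real mat \<Rightarrow> nat \<Rightarrow> bool" where
  "standing n A1 A2 B r \<longleftrightarrow>
     (\<exists>x1 x2. primal_feasible n A1 A2 B x1 x2) \<and>
     (\<forall>a b c. a \<cdot>\<^sub>m A1 + b \<cdot>\<^sub>m A2 + c \<cdot>\<^sub>m B = 0\<^sub>m n n \<longrightarrow> a = 0 \<and> b = 0 \<and> c = 0) \<and>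
     r < n \<and> B = Ir0 n r \<and>
     primal_feasible n A1 A2 B 0 0 \<and>
     (\<forall>x1 x2. primal_feasible n A1 A2 B x1 x2 \<longrightarrow>
        mrank n (slack A1 A2 B x1 x2) \<le> mrank n B)"

inductive reform_step ::
  "nat \<Rightarrow> real mat \<times> real mat \<times> real mat \<times> real \<times> real
       \<Rightarrow> real mat \<times> real mat \<times> real mat \<times> real \<times> real \<Rightarrow> bool"
  for n :: nat where
  op1a: "a \<noteq> 0 \<Longrightarrow> reform_step n (A1, A2, B, c1, c2) (A1, A2, B + a \<cdot>\<^sub>m A1, c1, c2)"
| op1b: "a \<noteq> 0 \<Longrightarrow> reform_step n (A1, A2, B, c1, c2) (A1, A2, B + a \<cdot>\<^sub>m A2, c1, c2)"
| op2: "reform_step n (A1, A2, B, c1, c2) (A2, A1, B, c2, c1)"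
| op3a: "a \<noteq> 0 \<Longrightarrow> reform_step n (A1, A2, B, c1, c2)
           (a \<cdot>\<^sub>m A1 + b \<cdot>\<^sub>m A2, A2, B, a * c1 + b * c2, c2)"
| op3b: "a \<noteq> 0 \<Longrightarrow> reform_step n (A1, A2, B, c1, c2)
           (A1, a \<cdot>\<^sub>m A2 + b \<cdot>\<^sub>m A1, B, c1, a * c2 + b * c1)"
| op4: "T \<in> carrier_mat n n \<Longrightarrow> invertible_mat T \<Longrightarrow> reform_step n (A1, A2, B, c1, c2)
           (transpose_mat T * A1 * T, transpose_mat T * A2 * T, transpose_mat T * B * T, c1, c2)"

definition reformulation ::
  "nat \<Rightarrow> real mat \<times> real mat \<times> real mat \<times> real \<times> real
       \<Rightarrow> real mat \<times> real mat \<times> real mat \<times> real \<times> real \<Rightarrow> bool" where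
  "reformulation n = (reform_step n)\<^sup>*\<^sup>*"

text \<open>The normal form of the theorem, with blocks I1 = [0,p), I2 = [p,r),
  I3 = [r,r+s), I4 = [r+s,n).\<close>
definition normal_form ::
  "nat \<Rightarrow> nat \<Rightarrow> real mat \<Rightarrow> real mat \<Rightarrow> real mat \<Rightarrow> real \<Rightarrow> real \<Rightarrow> bool" where
  "normal_form n r A1' A2' B' c1' c2' \<longleftrightarrow>
     c1' = 0 \<and> c2' > 0 \<and> B' = Ir0 n r \<and> sym_mat n A1' \<and> sym_mat n A2' \<and>
     (\<exists>p s. p \<le> r \<and> r + s \<le> n \<and>
       \<comment> \<open>A1' = Lambda (+) 0, Lambda p x p diagonal positive definite\<close>
       (\<forall>i<n. \<forall>j<n. (i \<noteq> j \<or> p \<le> i) \<longrightarrow> A1' $$ (i, j) = 0) \<and>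
       (\<forall>i<p. A1' $$ (i, i) > 0) \<and>
       \<comment> \<open>M = A2'(I1,I4) nonzero\<close>
       (\<exists>i<p. \<exists>j. r + s \<le> j \<and> j < n \<and> A2' $$ (i, j) \<noteq> 0) \<and>
       \<comment> \<open>A2'(I2,I2) = Sigma diagonal\<close>
       (\<forall>i j. p \<le> i \<and> i < r \<and> p \<le> j \<and> j < r \<and> i \<noteq> j \<longrightarrow> A2' $$ (i, j) = 0) \<and>
       \<comment> \<open>A2'(I2,I3) = 0, A2'(I2,I4) = 0\<close>
       (\<forall>i j. p \<le> i \<and> i < r \<and> r \<le> j \<and> j < n \<longrightarrow> A2' $$ (i, j) = 0) \<and>
       \<comment> \<open>A2'(I3,I3) = -I_s\<close>
       (\<forall>i j. r \<le> i \<and> i < r + s \<and> r \<le> j \<and> j < r + s \<longrightarrow>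
            A2' $$ (i, j) = (if i = j then -1 else 0)) \<and>
       \<comment> \<open>A2'(I3,I4) = 0, A2'(I4,I4) = 0\<close>
       (\<forall>i j. r \<le> i \<and> i < n \<and> r + s \<le> j \<and> j < n \<longrightarrow> A2' $$ (i, j) = 0))"

end

theory Submission
  imports Defs "Jordan_Normal_Form.Spectral_Radius" "HOL-Analysis.Convex_Euclidean_Space"
    "HOL-Combinatorics.Permutations"
begin

text \<open>Suppose there is a gap, and pick \<open>\<gamma>\<close> strictly between the two values. The vectors
  \<open>(A\<^sub>1 \<bullet> Y, A\<^sub>2 \<bullet> Y)\<close> with \<open>Y \<succeq> 0\<close> and \<open>B \<bullet> Y \<le> \<gamma>\<close> form a convex set in the plane that misses \<open>c\<close>;
  testing a separating direction \<open>d\<close> on rank-one matrices gives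
  \<open>\<gamma> (d\<^sub>1 A\<^sub>1 + d\<^sub>2 A\<^sub>2) \<preceq> (d \<bullet> c) B\<close>. If \<open>d \<bullet> c > 0\<close>, this would be a primal feasible point of value \<open>\<gamma>\<close>, so
  \<open>d \<bullet> c = 0\<close> and \<open>A\<^sub>1' = -(d\<^sub>1 A\<^sub>1 + d\<^sub>2 A\<^sub>2)\<close> is positive semidefinite with zero objective
  coefficient; since \<open>B + A\<^sub>1'\<close> is a slack, maximality of the rank of \<open>B\<close> confines \<open>A\<^sub>1'\<close> to the leading
  \<open>r \<times> r\<close> block. After diagonalizing \<open>A\<^sub>1'\<close>, dual feasible \<open>Y\<close> vanish on the support of
  \<open>A\<^sub>1'\<close>, and rank-one dual solutions of small value are excluded by the gap. This forces the
  lower right block of \<open>A\<^sub>2\<close> to be negative semidefinite, and the remaining zero blocks arise from a Schur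
  complement step and orthogonal changes of basis. Finally \<open>M = 0\<close> is impossible: with
  \<open>c\<^sub>2 x\<^sub>2 = \<gamma>\<close> and \<open>x\<^sub>1\<close> very negative one would get a primal feasible point.

  Conversely, in the normal form \<open>M \<noteq> 0\<close> forces \<open>x\<^sub>2 = 0\<close>, whereas every dual feasible \<open>Y\<close> lives
  outside the first block and satisfies \<open>c\<^sub>2 \<le> \<Sigma> \<bullet> Y\<close> on the second, which bounds \<open>B \<bullet> Y\<close> away from zero.\<close>

hide_const (open) Finite_Cartesian_Product.vec Finite_Cartesian_Product.mat
hide_type (open) Finite_Cartesian_Product.vec
no_notation Finite_Cartesian_Product.vec_nth (infixl "$" 90)

section \<open>Quadratic forms and congruence\<close>

text \<open>The bilinear form \<open>u^T A v\<close>. Vectors are functions on the naturals, of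
  which only the values below \<open>n\<close> matter, so that sums and multiples carry no dimension
  conditions.\<close>

definition qf :: "nat \<Rightarrow> real mat \<Rightarrow> (nat \<Rightarrow> real) \<Rightarrow> (nat \<Rightarrow> real) \<Rightarrow> real" where
  "qf n A u v = (\<Sum>i<n. \<Sum>j<n. u i * A $$ (i, j) * v j)"

lemma sym_matD:
  assumes "sym_mat n A"
  shows "A \<in> carrier_mat n n" and "dim_row A = n" and "dim_col A = n"
    and "i < n \<Longrightarrow> j < n \<Longrightarrow> A $$ (i, j) = A $$ (j, i)"
proof -
  show c: "A \<in> carrier_mat n n" "dim_row A = n" "dim_col A = n"
    using assms by (auto simp: sym_mat_def)
  assume ij: "i < n" "j < n"
  have "A $$ (i, j) = transpose_mat A $$ (i, j)" using assms by (simp add: sym_mat_def)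
  then show "A $$ (i, j) = A $$ (j, i)" using ij c by simp
qed

lemma sym_matI:
  assumes "A \<in> carrier_mat n n" and "\<And>i j. i < n \<Longrightarrow> j < n \<Longrightarrow> A $$ (i, j) = A $$ (j, i)"
  shows "sym_mat n A"
  using assms by (auto simp: sym_mat_def intro!: eq_matI)

lemma sym_mat_plus:
  assumes "sym_mat n A" "sym_mat n C"
  shows "sym_mat n (A + C)"
proof (rule sym_matI)
  fix i j assume "i < n" "j < n"
  then show "(A + C) $$ (i, j) = (A + C) $$ (j, i)"
    using assms[THEN sym_matD(4), of i j] by (simp add: assms[THEN sym_matD(2)] assms[THEN sym_matD(3)])
qed (use assms in \<open>simp add: sym_matD(1)\<close>)

lemma sym_mat_smult:
  assumes "sym_mat n A"
  shows "sym_mat n (a \<cdot>\<^sub>m A)"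
proof (rule sym_matI)
  fix i j assume "i < n" "j < n"
  then show "(a \<cdot>\<^sub>m A) $$ (i, j) = (a \<cdot>\<^sub>m A) $$ (j, i)"
    using sym_matD(4)[OF assms, of i j] by (simp add: sym_matD(2,3)[OF assms])
qed (use assms in \<open>simp add: sym_matD(1)\<close>)

lemma scalar_prod_mult_mat_vec:
  assumes "A \<in> carrier_mat n n" "v \<in> carrier_vec n" "w \<in> carrier_vec n"
  shows "scalar_prod w (A *\<^sub>v v) = qf n A (\<lambda>i. w $ i) (\<lambda>i. v $ i)"
  using assms
  by (simp add: qf_def scalar_prod_def sum_distrib_left atLeast0LessThan mult.assoc)

lemma qf_cong:
  assumes "\<And>i. i < n \<Longrightarrow> u i = u' i" "\<And>i. i < n \<Longrightarrow> v i = v' i"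
  shows "qf n A u v = qf n A u' v'"
  using assms by (simp add: qf_def)

lemma psd_iff_qf: "psd n A \<longleftrightarrow> sym_mat n A \<and> (\<forall>v. 0 \<le> qf n A v v)"
proof -
  have "0 \<le> qf n A v v"
    if "sym_mat n A" and *: "\<forall>v\<in>carrier_vec n. 0 \<le> scalar_prod v (A *\<^sub>v v)" for v
  proof -
    have "scalar_prod (vec n v) (A *\<^sub>v vec n v) = qf n A v v"
      using that by (subst scalar_prod_mult_mat_vec[OF sym_matD(1)]) (auto intro: qf_cong)
    then show ?thesis using * by (metis vec_carrier)
  qed
  then show ?thesis
    by (auto simp: psd_def scalar_prod_mult_mat_vec[OF sym_matD(1)])
qed

lemma qf_add_left: "qf n A (\<lambda>i. u i + w i) v = qf n A u v + qf n A w v"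
  by (simp add: qf_def ring_distribs sum.distrib)

lemma qf_add_right: "qf n A v (\<lambda>i. u i + w i) = qf n A v u + qf n A v w"
  by (simp add: qf_def ring_distribs sum.distrib)

lemma qf_scale_left: "qf n A (\<lambda>i. a * u i) v = a * qf n A u v"
  by (simp add: qf_def sum_distrib_left mult.assoc)

lemma qf_scale_right: "qf n A v (\<lambda>i. a * u i) = a * qf n A v u"
  by (simp add: qf_def sum_distrib_left mult_ac)

lemmas qf_linear = qf_add_left qf_add_right qf_scale_left qf_scale_right

lemma qf_plus_mat:
  assumes "A \<in> carrier_mat n n" "C \<in> carrier_mat n n"
  shows "qf n (A + C) u v = qf n A u v + qf n C u v"
  using assms by (simp add: qf_def ring_distribs sum.distrib)

lemma qf_smult_mat:
  assumes "A \<in> carrier_mat n n"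
  shows "qf n (a \<cdot>\<^sub>m A) u v = a * qf n A u v"
  using assms by (simp add: qf_def sum_distrib_left mult_ac)

lemma qf_minus_mat:
  assumes "A \<in> carrier_mat n n" "C \<in> carrier_mat n n"
  shows "qf n (A - C) u v = qf n A u v - qf n C u v"
  using assms by (simp add: qf_def ring_distribs sum_subtractf)

lemma qf_commute:
  assumes "sym_mat n A"
  shows "qf n A u v = qf n A v u"
proof -
  have "qf n A u v = (\<Sum>j<n. \<Sum>i<n. u i * A $$ (i, j) * v j)"
    unfolding qf_def by (rule sum.swap)
  also have "\<dots> = qf n A v u"
    unfolding qf_def by (intro sum.cong refl) (simp add: sym_matD(4)[OF assms] mult_ac)
  finally show ?thesis .
qed

text \<open>The standard basis vector \<open>e_j\<close>; read with the second argument as the row,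
  \<open>unit j k\<close> is also entry \<open>(k, j)\<close> of the identity matrix.\<close>

definition unit :: "nat \<Rightarrow> nat \<Rightarrow> real" where
  "unit j i = (if i = j then 1 else 0)"

lemma sum_unit_left:
  fixes f :: "nat \<Rightarrow> real"
  shows "j < n \<Longrightarrow> (\<Sum>i<n. unit j i * f i) = f j"
  by (simp add: unit_def if_distrib[where f = "\<lambda>x. x * _"] cong: if_cong)

lemma sum_unit_right:
  fixes f :: "nat \<Rightarrow> real"
  shows "j < n \<Longrightarrow> (\<Sum>i<n. f i * unit j i) = f j"
  using sum_unit_left[of j n f] by (simp add: mult.commute)

lemma qf_unit_left: "i < n \<Longrightarrow> qf n A (unit i) v = (\<Sum>j<n. A $$ (i, j) * v j)"
  unfolding qf_def by (simp add: sum_unit_left mult.assoc flip: sum_distrib_left)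

lemma qf_unit: "i < n \<Longrightarrow> j < n \<Longrightarrow> qf n A (unit i) (unit j) = A $$ (i, j)"
  by (simp add: qf_unit_left sum_unit_right)

lemma slack_carrier:
  assumes "A1 \<in> carrier_mat n n" "A2 \<in> carrier_mat n n" "B \<in> carrier_mat n n"
  shows "slack A1 A2 B x1 x2 \<in> carrier_mat n n"
  using assms by (simp add: slack_def minus_carrier_mat)

lemma slack_index:
  assumes "A1 \<in> carrier_mat n n" "A2 \<in> carrier_mat n n" "B \<in> carrier_mat n n" "i < n" "j < n"
  shows "slack A1 A2 B x1 x2 $$ (i, j) = B $$ (i, j) - x1 * A1 $$ (i, j) - x2 * A2 $$ (i, j)"
  using assms by (simp add: slack_def)

lemma slack_sym:
  assumes "sym_mat n A1" "sym_mat n A2" "sym_mat n B"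
  shows "sym_mat n (slack A1 A2 B x1 x2)"
proof (rule sym_matI)
  note c = assms[THEN sym_matD(1)]
  show "slack A1 A2 B x1 x2 \<in> carrier_mat n n" by (rule slack_carrier[OF c])
  fix i j assume ij: "i < n" "j < n"
  show "slack A1 A2 B x1 x2 $$ (i, j) = slack A1 A2 B x1 x2 $$ (j, i)"
    using ij by (simp add: slack_index[OF c] assms[THEN sym_matD(4), of i j])
qed

lemma qf_slack:
  assumes "A1 \<in> carrier_mat n n" "A2 \<in> carrier_mat n n" "B \<in> carrier_mat n n"
  shows "qf n (slack A1 A2 B x1 x2) u v = qf n B u v - x1 * qf n A1 u v - x2 * qf n A2 u v"
  using assms by (simp add: slack_def qf_minus_mat qf_smult_mat minus_carrier_mat)

lemma primal_feasible_iff: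
  assumes "sym_mat n A1" "sym_mat n A2" "sym_mat n B"
  shows "primal_feasible n A1 A2 B x1 x2 \<longleftrightarrow>
    (\<forall>v. x1 * qf n A1 v v + x2 * qf n A2 v v \<le> qf n B v v)"
  using assms by (simp add: primal_feasible_def psd_iff_qf slack_sym qf_slack sym_matD(1) algebra_simps)

section \<open>The trace inner product and rank-one test matrices\<close>

lemma mat_inner_sum:
  assumes "S \<in> carrier_mat n n" "T \<in> carrier_mat n n"
  shows "mat_inner n S T = (\<Sum>i<n. \<Sum>k<n. S $$ (i, k) * T $$ (k, i))"
  using assms by (simp add: mat_inner_def scalar_prod_def atLeast0LessThan)

lemma mat_inner_plus_left:
  assumes "A \<in> carrier_mat n n" "C \<in> carrier_mat n n" "Y \<in> carrier_mat n n"
  shows "mat_inner n (A + C) Y = mat_inner n A Y + mat_inner n C Y"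
  using assms by (simp add: mat_inner_sum ring_distribs sum.distrib)

lemma mat_inner_plus_right:
  assumes "A \<in> carrier_mat n n" "C \<in> carrier_mat n n" "Y \<in> carrier_mat n n"
  shows "mat_inner n Y (A + C) = mat_inner n Y A + mat_inner n Y C"
  using assms by (simp add: mat_inner_sum ring_distribs sum.distrib)

lemma mat_inner_smult_left:
  assumes "A \<in> carrier_mat n n" "Y \<in> carrier_mat n n"
  shows "mat_inner n (a \<cdot>\<^sub>m A) Y = a * mat_inner n A Y"
  using assms by (simp add: mat_inner_sum sum_distrib_left mult_ac)

lemma mat_inner_smult_right:
  assumes "A \<in> carrier_mat n n" "Y \<in> carrier_mat n n"
  shows "mat_inner n Y (a \<cdot>\<^sub>m A) = a * mat_inner n Y A"
  using assms by (simp add: mat_inner_sum sum_distrib_left mult_ac)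

text \<open>The matrix \<open>a w w^T\<close>. Testing on it turns conditions on dual matrices
  \<open>Y\<close> into inequalities between quadratic forms.\<close>

definition rank_one :: "nat \<Rightarrow> real \<Rightarrow> (nat \<Rightarrow> real) \<Rightarrow> real mat" where
  "rank_one n a w = mat n n (\<lambda>(i, j). a * (w i * w j))"

lemma mat_inner_rank_one:
  assumes "A \<in> carrier_mat n n"
  shows "mat_inner n A (rank_one n a w) = a * qf n A w w"
  using assms
  by (simp add: mat_inner_sum[of _ n] rank_one_def qf_def sum_distrib_left mult_ac)

lemma psd_rank_one:
  assumes "a \<ge> 0"
  shows "psd n (rank_one n a w)"
proof -
  have "qf n (rank_one n a w) v v = a * (\<Sum>i<n. w i * v i)\<^sup>2" for v
    by (simp add: qf_def rank_one_def power2_eq_square sum_product sum_distrib_left mult_ac)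
  moreover have "sym_mat n (rank_one n a w)"
    by (rule sym_matI) (auto simp: rank_one_def)
  ultimately show ?thesis
    using assms by (simp add: psd_iff_qf)
qed

lemma psd_carrier: "psd n A \<Longrightarrow> A \<in> carrier_mat n n"
  by (simp add: psd_def sym_mat_def)

lemma psd_diag_nonneg:
  assumes "psd n A" "i < n"
  shows "0 \<le> A $$ (i, i)"
  using assms by (metis psd_iff_qf qf_unit)

text \<open>Meant for perturbations \<open>e_i + s e_j\<close>: once the \<open>s^2\<close> term of
  a quadratic form is absent, a bound valid for all \<open>s\<close> kills the mixed entry.\<close>

lemma affine_nonpos_imp_slope_zero:
  fixes a b h :: real
  assumes "\<And>s. a + s * b \<le> h"
  shows "b = 0"
proof (rule ccontr)
  assume "b \<noteq> 0"
  \<comment> \<open>At this \<open>s\<close> the left side equals \<open>h + 1\<close>.\<close>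
  then show False using assms[of "(h - a + 1) / b"] by simp
qed

text \<open>Since \<open>A_jj = 0\<close>, the form at \<open>e_i + s e_j\<close> is
  \<open>A_ii + 2 s A_ij\<close>; being nonnegative for every real \<open>s\<close>, it has slope
  zero.\<close>

lemma psd_zero_diag:
  assumes "psd n A" "i < n" "j < n" "A $$ (j, j) = 0"
  shows "A $$ (i, j) = 0"
proof -
  have s: "sym_mat n A" using assms by (simp add: psd_def)
  have "- A $$ (i, i) + s * (- 2 * A $$ (i, j)) \<le> 0" for s
  proof -
    have "0 \<le> qf n A (\<lambda>k. unit i k + s * unit j k) (\<lambda>k. unit i k + s * unit j k)"
      using assms by (simp add: psd_iff_qf)
    then show ?thesis
      using assms sym_matD(4)[OF s, of i j] by (simp add: qf_linear qf_unit algebra_simps)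
  qed
  from affine_nonpos_imp_slope_zero[OF this] show ?thesis by simp
qed

lemma psd_plus: "psd n A \<Longrightarrow> psd n C \<Longrightarrow> psd n (A + C)"
  by (simp add: psd_iff_qf qf_plus_mat sym_matD(1) sym_mat_plus)

lemma psd_smult: "psd n A \<Longrightarrow> a \<ge> 0 \<Longrightarrow> psd n (a \<cdot>\<^sub>m A)"
  by (simp add: psd_iff_qf qf_smult_mat sym_matD(1) sym_mat_smult)

lemma Ir0_carrier [simp]: "Ir0 n r \<in> carrier_mat n n"
  by (simp add: Ir0_def)

lemma Ir0_index: "i < n \<Longrightarrow> j < n \<Longrightarrow> Ir0 n r $$ (i, j) = (if i = j \<and> i < r then 1 else 0)"
  by (simp add: Ir0_def)

lemma sum_offdiag_zero:
  fixes f :: "nat \<Rightarrow> nat \<Rightarrow> real"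
  assumes "\<And>i j. i < n \<Longrightarrow> j < n \<Longrightarrow> i \<noteq> j \<Longrightarrow> f i j = 0"
  shows "(\<Sum>i<n. \<Sum>j<n. f i j) = (\<Sum>i<n. f i i)"
proof (rule sum.cong[OF refl])
  fix i assume i: "i \<in> {..<n}"
  then have "(\<Sum>j<n. f i j) = (\<Sum>j\<in>{i}. f i j)"
    using assms by (intro sum.mono_neutral_right) auto
  then show "(\<Sum>j<n. f i j) = f i i" by simp
qed

lemma qf_diagonal:
  assumes "\<And>i j. i < n \<Longrightarrow> j < n \<Longrightarrow> i \<noteq> j \<Longrightarrow> D $$ (i, j) = 0"
  shows "qf n D v v = (\<Sum>i<n. D $$ (i, i) * (v i)\<^sup>2)"
  unfolding qf_def by (subst sum_offdiag_zero) (auto simp: assms power2_eq_square mult_ac)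

lemma mat_inner_diagonal:
  assumes "A \<in> carrier_mat n n" "Y \<in> carrier_mat n n"
    and "\<And>i j. i < n \<Longrightarrow> j < n \<Longrightarrow> i \<noteq> j \<Longrightarrow> A $$ (i, j) * Y $$ (j, i) = 0"
  shows "mat_inner n A Y = (\<Sum>i<n. A $$ (i, i) * Y $$ (i, i))"
  unfolding mat_inner_sum[OF assms(1,2)] by (rule sum_offdiag_zero) (rule assms(3))

lemma qf_Ir0: "qf n (Ir0 n r) v v = (\<Sum>i<n. if i < r then (v i)\<^sup>2 else 0)"
  by (subst qf_diagonal) (auto simp: Ir0_index intro!: sum.cong)

lemma psd_Ir0: "psd n (Ir0 n r)"
  by (auto simp: psd_iff_qf qf_Ir0 Ir0_index intro!: sym_matI sum_nonneg)

section \<open>Congruence transformations\<close>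

definition mcong :: "real mat \<Rightarrow> real mat \<Rightarrow> real mat" where
  "mcong T A = transpose_mat T * A * T"

lemma mcong_carrier: "T \<in> carrier_mat n n \<Longrightarrow> A \<in> carrier_mat n n \<Longrightarrow> mcong T A \<in> carrier_mat n n"
  by (simp add: mcong_def)

text \<open>The columns of \<open>T\<close> are the new basis vectors. Most block computations below
  start from this formula and ask what these columns look like.\<close>

lemma mcong_index:
  assumes "T \<in> carrier_mat n n" "A \<in> carrier_mat n n" "i < n" "j < n"
  shows "mcong T A $$ (i, j) = qf n A (\<lambda>k. T $$ (k, i)) (\<lambda>k. T $$ (k, j))"
  using assms
  by (simp add: mcong_def qf_def scalar_prod_def atLeast0LessThan sum_distrib_left mult.assoc)

lemma mcong_sym:
  assumes "T \<in> carrier_mat n n" "sym_mat n A"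
  shows "sym_mat n (mcong T A)"
  using assms by (intro sym_matI mcong_carrier) (auto simp: mcong_index sym_matD(1) qf_commute)

lemma mcong_mult:
  assumes T: "T \<in> carrier_mat n n" and U: "U \<in> carrier_mat n n" and A: "A \<in> carrier_mat n n"
  shows "mcong U (mcong T A) = mcong (T * U) A"
proof -
  let ?t = "transpose_mat T" and ?u = "transpose_mat U"
  have t: "?t \<in> carrier_mat n n" and u: "?u \<in> carrier_mat n n" using T U by simp_all
  have "mcong (T * U) A = (?u * ?t) * A * (T * U)"
    using T U by (simp add: mcong_def transpose_mult[of _ n n])
  also have "\<dots> = ?u * (?t * A) * (T * U)"
    by (subst assoc_mult_mat[OF u t A]) simp
  also have "\<dots> = (?u * (?t * A)) * T * U"
    by (rule assoc_mult_mat[symmetric, of _ n n _ n _ n]) (use t u A T U in auto)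
  also have "\<dots> = ?u * (?t * A * T) * U"
    by (subst assoc_mult_mat[of ?u n n _ n _ n]) (use t u A T U in auto)
  finally show ?thesis by (simp add: mcong_def)
qed

lemma qf_zero: "qf n A (\<lambda>k. 0) v = 0" "qf n A v (\<lambda>k. 0) = 0"
  by (simp_all add: qf_def)

lemma qf_sum_left: "qf n A (\<lambda>k. \<Sum>i\<in>I. f i k) v = (\<Sum>i\<in>I. qf n A (f i) v)"
  by (induction I rule: infinite_finite_induct) (simp_all add: qf_zero qf_add_left)

lemma qf_sum_right: "qf n A v (\<lambda>k. \<Sum>i\<in>I. f i k) = (\<Sum>i\<in>I. qf n A v (f i))"
  by (induction I rule: infinite_finite_induct) (simp_all add: qf_zero qf_add_right)

lemma qf_mcong:
  assumes "T \<in> carrier_mat n n" "A \<in> carrier_mat n n"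
  shows "qf n (mcong T A) u v =
    qf n A (\<lambda>k. \<Sum>i<n. u i * T $$ (k, i)) (\<lambda>k. \<Sum>j<n. v j * T $$ (k, j))"
  unfolding qf_sum_left qf_sum_right qf_scale_left qf_scale_right
  unfolding qf_def[of n "mcong T A"]
  using assms by (simp add: mcong_index sum_distrib_left mult_ac)

section \<open>Duality gaps under reformulation\<close>

text \<open>A strict gap expressed by two real bounds instead of extended reals. If a program has no
  feasible point, its condition holds vacuously, in agreement with the conventions for empty suprema
  and infima.\<close>

definition has_gap ::
  "nat \<Rightarrow> real mat \<times> real mat \<times> real mat \<times> real \<times> real \<Rightarrow> bool" where
  "has_gap n = (\<lambda>(A1, A2, B, c1, c2). \<exists>\<alpha> \<beta>. \<alpha> < \<beta> \<and>
    (\<forall>x1 x2. primal_feasible n A1 A2 B x1 x2 \<longrightarrow> c1 * x1 + c2 * x2 \<le> \<alpha>) \<and>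
    (\<forall>Y. psd n Y \<longrightarrow> mat_inner n A1 Y = c1 \<longrightarrow> mat_inner n A2 Y = c2 \<longrightarrow> \<beta> \<le> mat_inner n B Y))"

lemma has_gapI:
  assumes "\<alpha> < \<beta>"
    and "\<And>x1 x2. primal_feasible n A1 A2 B x1 x2 \<Longrightarrow> c1 * x1 + c2 * x2 \<le> \<alpha>"
    and "\<And>Y. psd n Y \<Longrightarrow> mat_inner n A1 Y = c1 \<Longrightarrow> mat_inner n A2 Y = c2 \<Longrightarrow> \<beta> \<le> mat_inner n B Y"
  shows "has_gap n (A1, A2, B, c1, c2)"
  using assms unfolding has_gap_def by auto

lemma has_gapE:
  assumes "has_gap n (A1, A2, B, c1, c2)"
  obtains \<alpha> \<beta> where "\<alpha> < \<beta>"
    and "\<And>x1 x2. primal_feasible n A1 A2 B x1 x2 \<Longrightarrow> c1 * x1 + c2 * x2 \<le> \<alpha>"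
    and "\<And>Y. psd n Y \<Longrightarrow> mat_inner n A1 Y = c1 \<Longrightarrow> mat_inner n A2 Y = c2 \<Longrightarrow> \<beta> \<le> mat_inner n B Y"
  using assms unfolding has_gap_def by auto

lemma valP_less_valD_iff:
  "valP n A1 A2 B c1 c2 < valD n A1 A2 B c1 c2 \<longleftrightarrow> has_gap n (A1, A2, B, c1, c2)"
proof
  assume "valP n A1 A2 B c1 c2 < valD n A1 A2 B c1 c2"
  \<comment> \<open>Density is used twice so that both bounds are real and distinct even when one of
    the values is infinite.\<close>
  then obtain \<alpha> where a: "valP n A1 A2 B c1 c2 < ereal \<alpha>" "ereal \<alpha> < valD n A1 A2 B c1 c2"
    using ereal_dense2 by blast
  then obtain \<beta> where b: "ereal \<alpha> < ereal \<beta>" "ereal \<beta> < valD n A1 A2 B c1 c2"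
    using ereal_dense2 by blast
  have "c1 * x1 + c2 * x2 \<le> \<alpha>" if "primal_feasible n A1 A2 B x1 x2" for x1 x2
  proof -
    have "ereal (c1 * x1 + c2 * x2) \<le> valP n A1 A2 B c1 c2"
      unfolding valP_def using that by (intro Sup_upper) blast
    then show ?thesis using a by (metis ereal_less_eq(3) less_imp_le order_trans)
  qed
  moreover have "\<beta> \<le> mat_inner n B Y"
    if "psd n Y" "mat_inner n A1 Y = c1" "mat_inner n A2 Y = c2" for Y
  proof -
    have "valD n A1 A2 B c1 c2 \<le> ereal (mat_inner n B Y)"
      unfolding valD_def using that by (intro Inf_lower) blast
    then show ?thesis using b by (metis ereal_less_eq(3) less_imp_le order_trans)
  qed
  ultimately show "has_gap n (A1, A2, B, c1, c2)"
    using b by (intro has_gapI[of \<alpha> \<beta>]) auto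
next
  assume "has_gap n (A1, A2, B, c1, c2)"
  then obtain \<alpha> \<beta> where ab: "\<alpha> < \<beta>"
    "\<And>x1 x2. primal_feasible n A1 A2 B x1 x2 \<Longrightarrow> c1 * x1 + c2 * x2 \<le> \<alpha>"
    "\<And>Y. psd n Y \<Longrightarrow> mat_inner n A1 Y = c1 \<Longrightarrow> mat_inner n A2 Y = c2 \<Longrightarrow> \<beta> \<le> mat_inner n B Y"
    unfolding has_gap_def by auto
  have "valP n A1 A2 B c1 c2 \<le> ereal \<alpha>"
    unfolding valP_def by (rule Sup_least) (auto dest: ab(2))
  also have "\<dots> < ereal \<beta>" using ab(1) by simp
  also have "\<dots> \<le> valD n A1 A2 B c1 c2"
    unfolding valD_def by (rule Inf_greatest) (auto dest: ab(3))
  finally show "valP n A1 A2 B c1 c2 < valD n A1 A2 B c1 c2" .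
qed

section \<open>Invariance of the gap under the four operations\<close>

definition sym_data ::
  "nat \<Rightarrow> real mat \<times> real mat \<times> real mat \<times> real \<times> real \<Rightarrow> bool" where
  "sym_data n = (\<lambda>(A1, A2, B, c1, c2). sym_mat n A1 \<and> sym_mat n A2 \<and> sym_mat n B)"

lemma mat_inner_commute:
  assumes "S \<in> carrier_mat n n" "T \<in> carrier_mat n n"
  shows "mat_inner n S T = mat_inner n T S"
  unfolding mat_inner_sum[OF assms] mat_inner_sum[OF assms(2,1)]
  by (subst sum.swap) (simp add: mult.commute)

text \<open>By cyclicity of the trace, \<open>Y \<mapsto> T Y T^T\<close> is adjoint to
  \<open>A \<mapsto> T^T A T\<close>. Hence it carries dual feasible points of the transformed
  program to those of the original one, with the same value.\<close>

lemma mat_inner_mcong: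
  assumes T: "T \<in> carrier_mat n n" and A: "A \<in> carrier_mat n n" and Y: "Y \<in> carrier_mat n n"
  shows "mat_inner n A (mcong (transpose_mat T) Y) = mat_inner n (mcong T A) Y"
proof -
  let ?t = "transpose_mat T"
  have t: "?t \<in> carrier_mat n n" using T by simp
  have "A * (T * Y * ?t) = A * (T * Y) * ?t"
    by (rule assoc_mult_mat[symmetric, of _ n n _ n _ n]) (use A T Y in auto)
  then have "mat_inner n A (mcong ?t Y) = mat_inner n (A * (T * Y)) ?t"
    by (simp add: mat_inner_def mcong_def)
  also have "\<dots> = mat_inner n ?t (A * (T * Y))"
    by (rule mat_inner_commute) (use A T Y in auto)
  also have "\<dots> = mat_inner n (mcong T A) Y"
  proof -
    have "?t * (A * (T * Y)) = ?t * (A * T * Y)"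
      by (subst assoc_mult_mat[OF A T Y]) simp
    also have "\<dots> = ?t * (A * T) * Y"
      by (rule assoc_mult_mat[symmetric, of _ n n _ n _ n]) (use A T Y in auto)
    also have "\<dots> = ?t * A * T * Y"
      by (subst assoc_mult_mat[OF t A T]) simp
    finally show ?thesis by (simp add: mat_inner_def mcong_def)
  qed
  finally show ?thesis .
qed

lemma psd_mcong:
  assumes "T \<in> carrier_mat n n" "psd n A"
  shows "psd n (mcong T A)"
  using assms by (simp add: psd_iff_qf mcong_sym qf_mcong psd_carrier)

lemma invertible_matE:
  assumes "invertible_mat T" "T \<in> carrier_mat n n"
  obtains U where "U \<in> carrier_mat n n" "T * U = 1\<^sub>m n" "U * T = 1\<^sub>m n"
proof -
  from assms obtain U where U: "T * U = 1\<^sub>m n" "U * T = 1\<^sub>m (dim_row U)"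
    by (auto simp: invertible_mat_def inverts_mat_def)
  have "dim_col (T * U) = n" "dim_col (U * T) = dim_row U" by (simp_all add: U)
  then have "U \<in> carrier_mat n n" using assms(2) by auto
  then show ?thesis using U that by auto
qed

lemma mcong_inverse:
  assumes "T \<in> carrier_mat n n" "U \<in> carrier_mat n n" "T * U = 1\<^sub>m n" "A \<in> carrier_mat n n"
  shows "mcong U (mcong T A) = A"
  using assms by (simp add: mcong_mult) (simp add: mcong_def)

lemma reform_step_sym_data:
  assumes "reform_step n s s'" "sym_data n s"
  shows "sym_data n s'"
  using assms
  by (cases rule: reform_step.cases)
    (auto simp: sym_data_def sym_mat_plus sym_mat_smult mcong_sym simp flip: mcong_def)

text \<open>Reversibility makes one-sided preservation of the gap under each operation enough for an
  equivalence.\<close>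

lemma reform_step_reverse:
  assumes "reform_step n s s'" "sym_data n s"
  shows "reform_step n s' s"
  using assms
proof (cases rule: reform_step.cases)
  case (op1a a A1 A2 B c1 c2)
  have "B + a \<cdot>\<^sub>m A1 + (- a) \<cdot>\<^sub>m A1 = B"
    using assms op1a by (intro eq_matI) (auto simp: sym_data_def sym_matD)
  then show ?thesis
    using reform_step.op1a[of "- a" n A1 A2 "B + a \<cdot>\<^sub>m A1" c1 c2] op1a by simp
next
  case (op1b a A1 A2 B c1 c2)
  have "B + a \<cdot>\<^sub>m A2 + (- a) \<cdot>\<^sub>m A2 = B"
    using assms op1b by (intro eq_matI) (auto simp: sym_data_def sym_matD)
  then show ?thesis
    using reform_step.op1b[of "- a" n A1 A2 "B + a \<cdot>\<^sub>m A2" c1 c2] op1b by simp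
next
  case (op2 A1 A2 B c1 c2)
  then show ?thesis by (auto intro: reform_step.op2)
next
  case (op3a a A1 A2 B c1 c2 b)
  have "(1 / a) \<cdot>\<^sub>m (a \<cdot>\<^sub>m A1 + b \<cdot>\<^sub>m A2) + (- b / a) \<cdot>\<^sub>m A2 = A1"
    using assms op3a by (intro eq_matI) (auto simp: sym_data_def sym_matD field_simps)
  moreover have "(1 / a) * (a * c1 + b * c2) + (- b / a) * c2 = c1"
    using op3a by (simp add: field_simps)
  ultimately show ?thesis
    using reform_step.op3a[of "1 / a" n "a \<cdot>\<^sub>m A1 + b \<cdot>\<^sub>m A2" A2 B "a * c1 + b * c2" c2 "- b / a"] op3a
    by (simp del: times_divide_eq_left)
next
  case (op3b a A1 A2 B c1 c2 b)
  have "(1 / a) \<cdot>\<^sub>m (a \<cdot>\<^sub>m A2 + b \<cdot>\<^sub>m A1) + (- b / a) \<cdot>\<^sub>m A1 = A2"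
    using assms op3b by (intro eq_matI) (auto simp: sym_data_def sym_matD field_simps)
  moreover have "(1 / a) * (a * c2 + b * c1) + (- b / a) * c1 = c2"
    using op3b by (simp add: field_simps)
  ultimately show ?thesis
    using reform_step.op3b[of "1 / a" n A1 "a \<cdot>\<^sub>m A2 + b \<cdot>\<^sub>m A1" B c1 "a * c2 + b * c1" "- b / a"] op3b
    by (simp del: times_divide_eq_left)
next
  case (op4 T A1 A2 B c1 c2)
  from invertible_matE[OF op4(4,3)] obtain U
    where U: "U \<in> carrier_mat n n" "T * U = 1\<^sub>m n" "U * T = 1\<^sub>m n" .
  have "invertible_mat U"
    using U op4(3) by (auto simp: invertible_mat_def inverts_mat_def)
  moreover have "mcong U (mcong T A) = A" if "sym_mat n A" for A
    using that op4(3) U by (simp add: mcong_inverse sym_matD(1))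
  ultimately show ?thesis
    using reform_step.op4[OF U(1), of "mcong T A1" "mcong T A2" "mcong T B" c1 c2] op4 assms(2)
    by (simp add: sym_data_def flip: mcong_def)
qed

text \<open>Each operation is a change of variables. Adding \<open>a A_i\<close> to \<open>B\<close>
  shifts \<open>x_i\<close> by \<open>a\<close> and both objectives by \<open>a c_i\<close>;
  exchanging or recombining the constraints transforms \<open>x\<close> linearly and leaves the dual
  feasible set unchanged; a congruence keeps \<open>x\<close> and transforms
  \<open>Y\<close>.\<close>

lemma reform_step_has_gap:
  assumes "reform_step n s s'" "sym_data n s" "has_gap n s"
  shows "has_gap n s'"
  using assms(1)
proof (cases rule: reform_step.cases)
  case (op1a a A1 A2 B c1 c2)
  from assms(2) have s: "sym_mat n A1" "sym_mat n A2" "sym_mat n B" by (auto simp: sym_data_def op1a)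
  note c = s[THEN sym_matD(1)]
  from assms(3)[unfolded op1a] show ?thesis unfolding op1a
  proof (rule has_gapE)
    fix \<alpha> \<beta> assume *: "\<alpha> < \<beta>"
      "\<And>x1 x2. primal_feasible n A1 A2 B x1 x2 \<Longrightarrow> c1 * x1 + c2 * x2 \<le> \<alpha>"
      "\<And>Y. psd n Y \<Longrightarrow> mat_inner n A1 Y = c1 \<Longrightarrow> mat_inner n A2 Y = c2 \<Longrightarrow> \<beta> \<le> mat_inner n B Y"
    show "has_gap n (A1, A2, B + a \<cdot>\<^sub>m A1, c1, c2)"
    proof (rule has_gapI)
      show "\<alpha> + a * c1 < \<beta> + a * c1" using * by simp
      show "c1 * x1 + c2 * x2 \<le> \<alpha> + a * c1"
        if "primal_feasible n A1 A2 (B + a \<cdot>\<^sub>m A1) x1 x2" for x1 x2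
      proof -
        have "primal_feasible n A1 A2 B (x1 - a) x2"
          using that s c by (simp add: primal_feasible_iff sym_mat_plus sym_mat_smult qf_plus_mat qf_smult_mat algebra_simps)
        from *(2)[OF this] show ?thesis by (simp add: algebra_simps)
      qed
      show "\<beta> + a * c1 \<le> mat_inner n (B + a \<cdot>\<^sub>m A1) Y"
        if "psd n Y" "mat_inner n A1 Y = c1" "mat_inner n A2 Y = c2" for Y
        using *(3)[OF that] that c by (simp add: mat_inner_plus_left mat_inner_smult_left psd_carrier)
    qed
  qed
next
  case (op1b a A1 A2 B c1 c2)
  from assms(2) have s: "sym_mat n A1" "sym_mat n A2" "sym_mat n B" by (auto simp: sym_data_def op1b)
  note c = s[THEN sym_matD(1)]
  from assms(3)[unfolded op1b] show ?thesis unfolding op1b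
  proof (rule has_gapE)
    fix \<alpha> \<beta> assume *: "\<alpha> < \<beta>"
      "\<And>x1 x2. primal_feasible n A1 A2 B x1 x2 \<Longrightarrow> c1 * x1 + c2 * x2 \<le> \<alpha>"
      "\<And>Y. psd n Y \<Longrightarrow> mat_inner n A1 Y = c1 \<Longrightarrow> mat_inner n A2 Y = c2 \<Longrightarrow> \<beta> \<le> mat_inner n B Y"
    show "has_gap n (A1, A2, B + a \<cdot>\<^sub>m A2, c1, c2)"
    proof (rule has_gapI)
      show "\<alpha> + a * c2 < \<beta> + a * c2" using * by simp
      show "c1 * x1 + c2 * x2 \<le> \<alpha> + a * c2"
        if "primal_feasible n A1 A2 (B + a \<cdot>\<^sub>m A2) x1 x2" for x1 x2
      proof -
        have "primal_feasible n A1 A2 B x1 (x2 - a)"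
          using that s c by (simp add: primal_feasible_iff sym_mat_plus sym_mat_smult qf_plus_mat qf_smult_mat algebra_simps)
        from *(2)[OF this] show ?thesis by (simp add: algebra_simps)
      qed
      show "\<beta> + a * c2 \<le> mat_inner n (B + a \<cdot>\<^sub>m A2) Y"
        if "psd n Y" "mat_inner n A1 Y = c1" "mat_inner n A2 Y = c2" for Y
        using *(3)[OF that] that c by (simp add: mat_inner_plus_left mat_inner_smult_left psd_carrier)
    qed
  qed
next
  case (op2 A1 A2 B c1 c2)
  from assms(2) have s: "sym_mat n A1" "sym_mat n A2" "sym_mat n B" by (auto simp: sym_data_def op2)
  from assms(3)[unfolded op2] show ?thesis unfolding op2
    by (rule has_gapE, intro has_gapI) (auto simp: primal_feasible_iff s add.commute)
next
  case (op3a a A1 A2 B c1 c2 b)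
  from assms(2) have s: "sym_mat n A1" "sym_mat n A2" "sym_mat n B" by (auto simp: sym_data_def op3a)
  note c = s[THEN sym_matD(1)]
  from assms(3)[unfolded op3a] show ?thesis unfolding op3a
  proof (rule has_gapE)
    fix \<alpha> \<beta> assume *: "\<alpha> < \<beta>"
      "\<And>x1 x2. primal_feasible n A1 A2 B x1 x2 \<Longrightarrow> c1 * x1 + c2 * x2 \<le> \<alpha>"
      "\<And>Y. psd n Y \<Longrightarrow> mat_inner n A1 Y = c1 \<Longrightarrow> mat_inner n A2 Y = c2 \<Longrightarrow> \<beta> \<le> mat_inner n B Y"
    show "has_gap n (a \<cdot>\<^sub>m A1 + b \<cdot>\<^sub>m A2, A2, B, a * c1 + b * c2, c2)"
    proof (rule has_gapI[OF *(1)])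
      show "(a * c1 + b * c2) * x1 + c2 * x2 \<le> \<alpha>"
        if "primal_feasible n (a \<cdot>\<^sub>m A1 + b \<cdot>\<^sub>m A2) A2 B x1 x2" for x1 x2
      proof -
        have "primal_feasible n A1 A2 B (a * x1) (x2 + b * x1)"
          using that s c by (simp add: primal_feasible_iff sym_mat_plus sym_mat_smult qf_plus_mat qf_smult_mat algebra_simps)
        from *(2)[OF this] show ?thesis by (simp add: algebra_simps)
      qed
      show "\<beta> \<le> mat_inner n B Y"
        if "psd n Y" "mat_inner n (a \<cdot>\<^sub>m A1 + b \<cdot>\<^sub>m A2) Y = a * c1 + b * c2" "mat_inner n A2 Y = c2" for Y
        using that *(3)[of Y] c op3a
        by (simp add: mat_inner_plus_left mat_inner_smult_left psd_carrier)
    qed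
  qed
next
  case (op3b a A1 A2 B c1 c2 b)
  from assms(2) have s: "sym_mat n A1" "sym_mat n A2" "sym_mat n B" by (auto simp: sym_data_def op3b)
  note c = s[THEN sym_matD(1)]
  from assms(3)[unfolded op3b] show ?thesis unfolding op3b
  proof (rule has_gapE)
    fix \<alpha> \<beta> assume *: "\<alpha> < \<beta>"
      "\<And>x1 x2. primal_feasible n A1 A2 B x1 x2 \<Longrightarrow> c1 * x1 + c2 * x2 \<le> \<alpha>"
      "\<And>Y. psd n Y \<Longrightarrow> mat_inner n A1 Y = c1 \<Longrightarrow> mat_inner n A2 Y = c2 \<Longrightarrow> \<beta> \<le> mat_inner n B Y"
    show "has_gap n (A1, a \<cdot>\<^sub>m A2 + b \<cdot>\<^sub>m A1, B, c1, a * c2 + b * c1)"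
    proof (rule has_gapI[OF *(1)])
      show "c1 * x1 + (a * c2 + b * c1) * x2 \<le> \<alpha>"
        if "primal_feasible n A1 (a \<cdot>\<^sub>m A2 + b \<cdot>\<^sub>m A1) B x1 x2" for x1 x2
      proof -
        have "primal_feasible n A1 A2 B (x1 + b * x2) (a * x2)"
          using that s c by (simp add: primal_feasible_iff sym_mat_plus sym_mat_smult qf_plus_mat qf_smult_mat algebra_simps)
        from *(2)[OF this] show ?thesis by (simp add: algebra_simps)
      qed
      show "\<beta> \<le> mat_inner n B Y"
        if "psd n Y" "mat_inner n A1 Y = c1" "mat_inner n (a \<cdot>\<^sub>m A2 + b \<cdot>\<^sub>m A1) Y = a * c2 + b * c1" for Y
        using that *(3)[of Y] c op3b
        by (simp add: mat_inner_plus_left mat_inner_smult_left psd_carrier)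
    qed
  qed
next
  case (op4 T A1 A2 B c1 c2)
  from assms(2) have s: "sym_mat n A1" "sym_mat n A2" "sym_mat n B" by (auto simp: sym_data_def op4)
  note c = s[THEN sym_matD(1)]
  note T = op4(3)
  from invertible_matE[OF op4(4,3)] obtain U
    where U: "U \<in> carrier_mat n n" "T * U = 1\<^sub>m n" "U * T = 1\<^sub>m n" .
  from assms(3)[unfolded op4] show ?thesis unfolding op4 mcong_def[symmetric]
  proof (rule has_gapE)
    fix \<alpha> \<beta> assume *: "\<alpha> < \<beta>"
      "\<And>x1 x2. primal_feasible n A1 A2 B x1 x2 \<Longrightarrow> c1 * x1 + c2 * x2 \<le> \<alpha>"
      "\<And>Y. psd n Y \<Longrightarrow> mat_inner n A1 Y = c1 \<Longrightarrow> mat_inner n A2 Y = c2 \<Longrightarrow> \<beta> \<le> mat_inner n B Y"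
    show "has_gap n (mcong T A1, mcong T A2, mcong T B, c1, c2)"
    proof (rule has_gapI[OF *(1)])
      fix x1 x2 assume f: "primal_feasible n (mcong T A1) (mcong T A2) (mcong T B) x1 x2"
      \<comment> \<open>The map \<open>v \<mapsto> U v\<close>. As \<open>T U\<close> is the
        identity, the form of \<open>mcong T A\<close> at \<open>U v\<close> is the form of
        \<open>A\<close> at \<open>v\<close>.\<close>
      let ?U = "\<lambda>v k. \<Sum>i<n. v i * U $$ (k, i)"
      have e: "qf n A v v = qf n (mcong T A) (?U v) (?U v)" if "A \<in> carrier_mat n n" for A v
        using qf_mcong[OF U(1) mcong_carrier[OF T that], of v v] that
        by (simp add: mcong_inverse[OF T U(1,2)])
      have "primal_feasible n A1 A2 B x1 x2"
        using f by (simp add: primal_feasible_iff s mcong_sym T e[OF c(1)] e[OF c(2)] e[OF c(3)])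
      then show "c1 * x1 + c2 * x2 \<le> \<alpha>" by (rule *(2))
    next
      fix Y assume Y: "psd n Y" "mat_inner n (mcong T A1) Y = c1" "mat_inner n (mcong T A2) Y = c2"
      have "psd n (mcong (transpose_mat T) Y)"
        by (rule psd_mcong) (use T Y in auto)
      from *(3)[OF this] Y show "\<beta> \<le> mat_inner n (mcong T B) Y"
        by (simp add: mat_inner_mcong[OF T] c psd_carrier)
    qed
  qed
qed

lemma reformulation_has_gap:
  assumes "reformulation n s s'" "sym_data n s"
  shows "sym_data n s'" and "has_gap n s' \<longleftrightarrow> has_gap n s"
proof -
  have "sym_data n s' \<and> (has_gap n s' \<longleftrightarrow> has_gap n s)"
    using assms unfolding reformulation_def
  proof (induction rule: rtranclp_induct)
    case (step t u)
    then have t: "sym_data n t" "has_gap n t \<longleftrightarrow> has_gap n s" by auto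
    have u: "sym_data n u" by (rule reform_step_sym_data[OF step(2) t(1)])
    show ?case
      using reform_step_has_gap[OF step(2) t(1)] u t
        reform_step_has_gap[OF reform_step_reverse[OF step(2) t(1)] u] by blast
  qed simp
  then show "sym_data n s'" "has_gap n s' \<longleftrightarrow> has_gap n s" by auto
qed

section \<open>Slacks of maximum rank\<close>

text \<open>Coordinate projections, generalizing \<open>Ir0\<close>; they fill up missing
  coordinates in a rank count.\<close>

definition diag01 :: "nat \<Rightarrow> nat set \<Rightarrow> real mat" where
  "diag01 n J = mat n n (\<lambda>(i, j). if i = j \<and> i \<in> J then 1 else 0)"

lemma diag01_carrier: "diag01 n J \<in> carrier_mat n n"
  by (simp add: diag01_def)

lemma qf_diag01:
  "qf n (diag01 n J) v v = (\<Sum>i<n. if i \<in> J then (v i)\<^sup>2 else 0)"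
  by (subst qf_diagonal) (auto simp: diag01_def intro!: sum.cong)

text \<open>Each index contributes a matrix of rank at most one, and rank is subadditive.\<close>

lemma mrank_diag01_le:
  assumes "finite J"
  shows "mrank n (diag01 n J) \<le> card J"
  using assms
proof (induction J rule: finite_induct)
  case empty
  have "diag01 n {} = 0\<^sub>m n n" by (auto simp: diag01_def)
  then show ?case by (simp add: mrank_def vec_space.rank_0I)
next
  case (insert k J)
  have "diag01 n (insert k J) = diag01 n J + diag01 n {k}"
    using insert(2) by (auto simp: diag01_def intro!: eq_matI)
  moreover have "vec_space.rank n (diag01 n {k}) \<le> 1"
    by (rule vec_space.rank_le_1_product_entries[where f = "unit k" and g = "unit k"])
      (auto simp: diag01_def unit_def)
  ultimately show ?case
    using vec_space.rank_subadditive[OF diag01_carrier diag01_carrier, of n J "{k}"] insert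
    by (simp add: mrank_def)
qed

text \<open>A nonzero kernel vector would give the form the value 0. The condition
  \<open>v i \<noteq> 0\<close> for some \<open>i < n\<close> expresses that \<open>v\<close> is a
  nonzero vector of length \<open>n\<close>.\<close>

lemma mrank_positive_definite:
  assumes W: "W \<in> carrier_mat n n"
    and pos: "\<And>v i. i < n \<Longrightarrow> v i \<noteq> 0 \<Longrightarrow> 0 < qf n W v v"
  shows "mrank n W = n"
proof -
  have "det W \<noteq> 0"
  proof
    assume "det W = 0"
    then obtain v where v: "v \<in> carrier_vec n" "v \<noteq> 0\<^sub>v n" "W *\<^sub>v v = 0\<^sub>v n"
      using det_0_iff_vec_prod_zero_field[OF W] by auto
    then obtain i where "i < n" "v $ i \<noteq> 0" by (metis carrier_vecD eq_vecI index_zero_vec)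
    then have "0 < qf n W (\<lambda>i. v $ i) (\<lambda>i. v $ i)" by (rule pos)
    also have "\<dots> = 0" using v W by (simp flip: scalar_prod_mult_mat_vec)
    finally show False by simp
  qed
  then show ?thesis using vec_space.low_rank_det_zero[OF W] by (simp add: mrank_def)
qed

text \<open>Suppose \<open>S_jj > 0\<close> for some \<open>j \<ge> r\<close>. Adding ones on the
  \<open>n - r - 1\<close> other diagonal positions from \<open>r\<close> on makes
  \<open>Ir0 n r + S\<close> positive definite, so by subadditivity its rank is at least
  \<open>r + 1\<close>, whereas \<open>Ir0 n r\<close> has rank at most \<open>r\<close>. Hence
  \<open>S_jj = 0\<close>, and semidefiniteness clears the whole column.\<close>

lemma psd_max_rank_zero_block:
  assumes S: "psd n S" and r: "r \<le> n"
    and rank: "mrank n (Ir0 n r + S) \<le> mrank n (Ir0 n r)"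
    and i: "i < n" and j: "r \<le> j" "j < n"
  shows "S $$ (i, j) = 0"
proof (rule psd_zero_diag[OF S i j(2)], rule ccontr)
  assume "S $$ (j, j) \<noteq> 0"
  then have Sj: "S $$ (j, j) > 0" using psd_diag_nonneg[OF S j(2)] by simp
  let ?J = "{r..<n} - {j}"
  let ?W = "Ir0 n r + S + diag01 n ?J"
  have cS: "S \<in> carrier_mat n n" using S by (rule psd_carrier)
  have q: "qf n ?W v v = (\<Sum>k<n. if k \<noteq> j then (v k)\<^sup>2 else 0) + qf n S v v" for v
  proof -
    have "(\<Sum>k<n. if k < r then (v k)\<^sup>2 else 0) + (\<Sum>k<n. if k \<in> ?J then (v k)\<^sup>2 else 0) =
      (\<Sum>k<n. if k \<noteq> j then (v k)\<^sup>2 else 0)"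
      unfolding sum.distrib[symmetric] using j by (intro sum.cong) auto
    then show ?thesis
      using cS by (simp add: qf_plus_mat diag01_carrier qf_Ir0 qf_diag01)
  qed
  have "mrank n ?W = n"
  proof (rule mrank_positive_definite)
    fix v :: "nat \<Rightarrow> real" and i assume i: "i < n" "v i \<noteq> 0"
    have S0: "0 \<le> qf n S v v" using S by (simp add: psd_iff_qf)
    show "0 < qf n ?W v v"
    proof (cases "\<exists>k<n. k \<noteq> j \<and> v k \<noteq> 0")
      case True
      then obtain k where k: "k < n" "k \<noteq> j" "v k \<noteq> 0" by auto
      then have "0 < (\<Sum>k<n. if k \<noteq> j then (v k)\<^sup>2 else 0)"
        by (intro sum_pos2[of _ k]) auto
      then show ?thesis using S0 by (simp add: q)
    next
      case False
      then have "j = i" using i by auto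
      \<comment> \<open>Here \<open>v\<close> is a multiple of \<open>e_j\<close>, the one direction
        not covered by the added ones; \<open>S_jj\<close> takes over.\<close>
      have "qf n S v v = qf n S (\<lambda>k. v j * unit j k) (\<lambda>k. v j * unit j k)"
        using False by (intro qf_cong) (auto simp: unit_def)
      also have "\<dots> > 0"
        using Sj i \<open>j = i\<close> by (simp add: qf_linear qf_unit flip: mult.assoc power2_eq_square)
      finally show ?thesis unfolding q by (intro add_nonneg_pos sum_nonneg) auto
    qed
  qed (use cS in \<open>simp add: diag01_carrier\<close>)
  moreover have "mrank n ?W \<le> mrank n (Ir0 n r + S) + mrank n (diag01 n ?J)"
    unfolding mrank_def using cS by (intro vec_space.rank_subadditive) (auto simp: diag01_carrier)
  moreover have "Ir0 n r = diag01 n {..<r}"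
    by (auto simp: Ir0_def diag01_def)
  then have "mrank n (Ir0 n r) \<le> r"
    using mrank_diag01_le[of "{..<r}" n] by simp
  moreover have "mrank n (diag01 n ?J) \<le> n - r - 1"
    using mrank_diag01_le[of ?J n] j by simp
  ultimately show False using rank j by linarith
qed

section \<open>The separation argument\<close>

text \<open>The vector \<open>d\<close> is a recession direction of the primal feasible set along
  which the objective is constant. It arises as the normal of a line separating \<open>c\<close>
  from the image of a set of dual candidates of small value.\<close>

lemma gap_recession_direction:
  assumes s: "sym_mat n A1" "sym_mat n A2" and B: "psd n B"
    and gap: "has_gap n (A1, A2, B, c1, c2)"
  obtains d1 d2 where "d1 \<noteq> 0 \<or> d2 \<noteq> 0" "d1 * c1 + d2 * c2 = 0"
    "\<And>v. d1 * qf n A1 v v + d2 * qf n A2 v v \<le> 0"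
proof -
  have sB: "sym_mat n B" using B by (simp add: psd_def)
  note c = s[THEN sym_matD(1)] sB[THEN sym_matD(1)]
  note feas = primal_feasible_iff[OF s sB]
  from gap obtain \<alpha> \<beta> where ab: "\<alpha> < \<beta>"
    and P: "\<And>x1 x2. primal_feasible n A1 A2 B x1 x2 \<Longrightarrow> c1 * x1 + c2 * x2 \<le> \<alpha>"
    and D: "\<And>Y. psd n Y \<Longrightarrow> mat_inner n A1 Y = c1 \<Longrightarrow> mat_inner n A2 Y = c2 \<Longrightarrow> \<beta> \<le> mat_inner n B Y"
    by (rule has_gapE) (rule that)
  have B0: "0 \<le> qf n B v v" for v using B by (simp add: psd_iff_qf)
  have "0 \<le> \<alpha>" using P[of 0 0] B0 by (simp add: feas)
  \<comment> \<open>A value strictly between the bounds: no primal feasible point attains it, no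
    dual feasible \<open>Y\<close> gets down to it, and it is positive because \<open>x = 0\<close>
    is feasible.\<close>
  define \<gamma> where "\<gamma> = (\<alpha> + \<beta>) / 2"
  have g: "\<alpha> < \<gamma>" "\<gamma> < \<beta>" "0 < \<gamma>" using ab \<open>0 \<le> \<alpha>\<close> by (auto simp: \<gamma>_def)
  define K where "K = {(mat_inner n A1 Y, mat_inner n A2 Y) | Y. psd n Y \<and> mat_inner n B Y \<le> \<gamma>}"
  have KI: "(t * qf n A1 w w, t * qf n A2 w w) \<in> K" if "0 \<le> t" "t * qf n B w w \<le> \<gamma>" for t w
    unfolding K_def using that psd_rank_one[of t n w]
    by (auto intro!: exI[of _ "rank_one n t w"] simp: mat_inner_rank_one c)
  have "convex K"
  proof (rule convexI)
    fix x y :: "real \<times> real" and u v :: real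
    assume xy: "x \<in> K" "y \<in> K" and uv: "0 \<le> u" "0 \<le> v" "u + v = 1"
    from xy obtain X Y where X: "x = (mat_inner n A1 X, mat_inner n A2 X)" "psd n X" "mat_inner n B X \<le> \<gamma>"
      and Y: "y = (mat_inner n A1 Y, mat_inner n A2 Y)" "psd n Y" "mat_inner n B Y \<le> \<gamma>"
      by (auto simp: K_def)
    let ?Z = "u \<cdot>\<^sub>m X + v \<cdot>\<^sub>m Y"
    have Z: "mat_inner n A ?Z = u * mat_inner n A X + v * mat_inner n A Y" if "A \<in> carrier_mat n n" for A
      using that X(2) Y(2) by (simp add: mat_inner_plus_right mat_inner_smult_right psd_carrier)
    have "psd n ?Z" using X Y uv by (intro psd_plus psd_smult) auto
    moreover have "mat_inner n B ?Z \<le> \<gamma>"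
      using convex_bound_le[OF X(3) Y(3) uv] by (simp add: Z c)
    moreover have "u *\<^sub>R x + v *\<^sub>R y = (mat_inner n A1 ?Z, mat_inner n A2 ?Z)"
      using X(1) Y(1) by (simp add: Z c)
    ultimately show "u *\<^sub>R x + v *\<^sub>R y \<in> K" unfolding K_def by blast
  qed
  moreover have "K \<noteq> {}" using KI[of 0] g by fastforce
  moreover have "K \<inter> {(c1, c2)} = {}"
    unfolding K_def using D g by (auto simp: not_le dest: less_le_trans)
  \<comment> \<open>The separation is only weak, so the inequalities drawn from it are not strict;
    strictness comes from the choice of \<open>\<gamma>\<close>.\<close>
  ultimately obtain d h where d: "d \<noteq> 0" "\<forall>x\<in>K. inner d x \<le> h" "\<forall>x\<in>{(c1, c2)}. h \<le> inner d x"
    by (metis separating_hyperplane_sets convex_singleton insert_not_empty)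
  obtain d1 d2 where d12: "d = (d1, d2)" by (cases d)
  define a where "a v = d1 * qf n A1 v v + d2 * qf n A2 v v" for v
  define e where "e = d1 * c1 + d2 * c2"
  have sep: "t * a w \<le> e" if "0 \<le> t" "t * qf n B w w \<le> \<gamma>" for t w
    using order_trans[OF bspec[OF d(2) KI[OF that]]] d(3) by (simp add: d12 a_def e_def algebra_simps)
  have e0: "0 \<le> e" using sep[of 0] g by simp
  \<comment> \<open>Homogenization of \<open>sep\<close>. If the form of \<open>B\<close> vanishes
    at \<open>w\<close>, every \<open>t \<ge> 0\<close> is admissible and a positive
    \<open>a w\<close> would be unbounded; otherwise the largest admissible \<open>t\<close> gives
    the claim.\<close>
  have *: "\<gamma> * a w \<le> e * qf n B w w" for w
  proof (cases "qf n B w w = 0")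
    case True
    have "a w \<le> 0"
    proof (rule ccontr)
      assume "\<not> a w \<le> 0"
      then show False using sep[of "(e + 1) / a w" w] True g e0 by simp
    qed
    then show ?thesis using True g by (simp add: mult_nonneg_nonpos)
  next
    case False
    then have "0 < qf n B w w" using B0[of w] by simp
    then show ?thesis using sep[of "\<gamma> / qf n B w w" w] g by (simp add: field_simps)
  qed
  have "e = 0"
  proof (rule ccontr)
    assume "e \<noteq> 0"
    then have e: "e > 0" using e0 by simp
    \<comment> \<open>Dividing the form inequality by \<open>e\<close> exhibits a feasible point of
      objective value \<open>\<gamma>\<close>, which exceeds \<open>\<alpha>\<close>.\<close>
    have "primal_feasible n A1 A2 B (\<gamma> / e * d1) (\<gamma> / e * d2)"
      unfolding feas
    proof
      fix v
      have "\<gamma> / e * d1 * qf n A1 v v + \<gamma> / e * d2 * qf n A2 v v = \<gamma> * a v / e"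
        using e by (simp add: a_def field_simps)
      also have "\<dots> \<le> qf n B v v" using *[of v] e by (simp add: field_simps)
      finally show "\<gamma> / e * d1 * qf n A1 v v + \<gamma> / e * d2 * qf n A2 v v \<le> qf n B v v" .
    qed
    from P[OF this] have "\<gamma> / e * (d1 * c1 + d2 * c2) \<le> \<alpha>" by (simp add: algebra_simps)
    then show False using e g by (simp add: e_def[symmetric])
  qed
  show ?thesis
  proof (rule that[of d1 d2])
    show "d1 \<noteq> 0 \<or> d2 \<noteq> 0" using d(1) d12 by (auto simp: zero_prod_def)
    show "d1 * c1 + d2 * c2 = 0" using \<open>e = 0\<close> by (simp add: e_def)
    show "d1 * qf n A1 v v + d2 * qf n A2 v v \<le> 0" for v
      using *[of v] \<open>e = 0\<close> g by (simp add: a_def mult_le_0_iff)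
  qed
qed

section \<open>The normal form has a gap\<close>

text \<open>Primal side: a slack has zero diagonal on the last block, so its columns there vanish,
  and a nonzero entry of \<open>M\<close> forces \<open>x2 = 0\<close>. Dual side:
  \<open>A1 \<bullet> Y = 0\<close> clears the first \<open>p\<close> rows and columns of
  \<open>Y\<close>, and on the remaining indices \<open>A2\<close> is diagonal, with nonpositive
  entries from \<open>r\<close> on.\<close>

lemma normal_form_has_gap:
  assumes nf: "normal_form n r A1 A2 B c1 c2"
  shows "has_gap n (A1, A2, B, c1, c2)"
proof -
  from nf obtain p s where c: "c1 = 0" "c2 > 0" and B: "B = Ir0 n r"
    and sym: "sym_mat n A1" "sym_mat n A2"
    and p: "p \<le> r" "r + s \<le> n"
    and A1': "\<forall>i<n. \<forall>j<n. (i \<noteq> j \<or> p \<le> i) \<longrightarrow> A1 $$ (i, j) = 0"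
    and L': "\<forall>i<p. A1 $$ (i, i) > 0"
    and M: "\<exists>i<p. \<exists>j. r + s \<le> j \<and> j < n \<and> A2 $$ (i, j) \<noteq> 0"
    and I22': "\<forall>i j. p \<le> i \<and> i < r \<and> p \<le> j \<and> j < r \<and> i \<noteq> j \<longrightarrow> A2 $$ (i, j) = 0"
    and I23': "\<forall>i j. p \<le> i \<and> i < r \<and> r \<le> j \<and> j < n \<longrightarrow> A2 $$ (i, j) = 0"
    and I33': "\<forall>i j. r \<le> i \<and> i < r + s \<and> r \<le> j \<and> j < r + s \<longrightarrow>
        A2 $$ (i, j) = (if i = j then - 1 else 0)"
    and I34': "\<forall>i j. r \<le> i \<and> i < n \<and> r + s \<le> j \<and> j < n \<longrightarrow> A2 $$ (i, j) = 0"
    unfolding normal_form_def by - (elim conjE, elim exE, elim conjE, rule that)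
  note A1 = A1'[rule_format] and L = L'[rule_format] and I22 = I22'[rule_format]
    and I23 = I23'[rule_format] and I33 = I33'[rule_format] and I34 = I34'[rule_format]
  have sB: "sym_mat n B" using psd_Ir0[of n r] by (simp add: B psd_def)
  note cm = sym[THEN sym_matD(1)] sB[THEN sym_matD(1)]
  have off: "A2 $$ (i, j) = 0" if "p \<le> i" "p \<le> j" "i < n" "j < n" "i \<noteq> j" for i j
  proof -
    have *: "A2 $$ (i, j) = 0" if "p \<le> i" "i < j" "j < n" for i j
      using that p I22[of i j] I23[of i j] I33[of i j] I34[of i j]
      by (cases "i < r"; cases "j < r"; cases "j < r + s") auto
    then show ?thesis
      using that *[of i j] *[of j i] sym_matD(4)[OF sym(2), of i j] by (cases "i < j") auto
  qed
  \<comment> \<open>A convenient upper bound for the diagonal of \<open>A2\<close>; the summand 1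
    keeps it positive.\<close>
  define m where "m = 1 + (\<Sum>i<n. \<bar>A2 $$ (i, i)\<bar>)"
  have m: "m > 0" unfolding m_def by (intro add_pos_nonneg sum_nonneg) auto
  have mi: "A2 $$ (i, i) \<le> m" if "i < n" for i
  proof -
    have "\<bar>A2 $$ (i, i)\<bar> \<le> (\<Sum>i<n. \<bar>A2 $$ (i, i)\<bar>)"
      using that by (intro member_le_sum) auto
    then show ?thesis unfolding m_def by linarith
  qed
  show ?thesis
  proof (rule has_gapI[of 0 "c2 / m"])
    show "0 < c2 / m" using c m by simp
    fix x1 x2 assume f: "primal_feasible n A1 A2 B x1 x2"
    from M obtain i j where ij: "i < p" "r + s \<le> j" "j < n" "A2 $$ (i, j) \<noteq> 0" by blast
    have "slack A1 A2 B x1 x2 $$ (j, j) = 0"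
      using ij p by (subst slack_index[OF cm]) (auto simp: A1 I34 B Ir0_index)
    then have "slack A1 A2 B x1 x2 $$ (i, j) = 0"
      using psd_zero_diag[of n "slack A1 A2 B x1 x2" i j] f ij p by (simp add: primal_feasible_def)
    moreover have "slack A1 A2 B x1 x2 $$ (i, j) = - x2 * A2 $$ (i, j)"
      using ij p by (subst slack_index[OF cm]) (auto simp: A1 B Ir0_index)
    ultimately show "c1 * x1 + c2 * x2 \<le> 0" using ij c by simp
  next
    fix Y assume Y: "psd n Y" "mat_inner n A1 Y = c1" "mat_inner n A2 Y = c2"
    note cY = psd_carrier[OF Y(1)]
    have "(\<Sum>i<n. A1 $$ (i, i) * Y $$ (i, i)) = 0"
      using Y(2) c A1 by (subst mat_inner_diagonal[symmetric, OF cm(1) cY]) auto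
    moreover have nn: "0 \<le> A1 $$ (i, i) * Y $$ (i, i)" if "i < n" for i
      using that L[of i] A1[of i i] psd_diag_nonneg[OF Y(1) that] by (cases "i < p") auto
    ultimately have *: "A1 $$ (i, i) * Y $$ (i, i) = 0" if "i < n" for i
      using that by (subst (asm) sum_nonneg_eq_0_iff) auto
    then have Yii: "Y $$ (i, i) = 0" if "i < p" for i
    proof -
      have "i < n" using that p by simp
      then show ?thesis using *[of i] L[OF that] by simp
    qed
    have Yp: "Y $$ (i, j) = 0" if "i < n" "j < n" "i < p \<or> j < p" for i j
    proof -
      have sY: "sym_mat n Y" using Y(1) by (simp add: psd_def)
      show ?thesis
        using that psd_zero_diag[OF Y(1) that(1,2)] psd_zero_diag[OF Y(1) that(2,1)]
          Yii[of i] Yii[of j] sym_matD(4)[OF sY that(1,2)] by auto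
    qed
    have "c2 = (\<Sum>i<n. A2 $$ (i, i) * Y $$ (i, i))"
      unfolding Y(3)[symmetric]
    proof (rule mat_inner_diagonal[OF cm(2) cY])
      fix i j assume "i < n" "j < n" "i \<noteq> j"
      then show "A2 $$ (i, j) * Y $$ (j, i) = 0"
        using off[of i j] Yp[of j i] by (cases "i < p \<or> j < p") auto
    qed
    \<comment> \<open>For \<open>i < r\<close> the entry \<open>B_ii\<close> is 1 and
      \<open>m\<close> bounds \<open>A2_ii\<close>; for \<open>i \<ge> r\<close> the right side is 0
      and \<open>A2_ii\<close> is nonpositive.\<close>
    also have "\<dots> \<le> (\<Sum>i<n. m * (B $$ (i, i) * Y $$ (i, i)))"
    proof (rule sum_mono)
      fix i assume "i \<in> {..<n}"
      then have i: "i < n" by simp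
      have y: "0 \<le> Y $$ (i, i)" by (rule psd_diag_nonneg[OF Y(1) i])
      have "A2 $$ (i, i) \<le> 0" if "r \<le> i"
        using that i I33[of i i] I34[of i i] by (cases "i < r + s") auto
      then show "A2 $$ (i, i) * Y $$ (i, i) \<le> m * (B $$ (i, i) * Y $$ (i, i))"
        using mi[OF i] y i by (cases "i < r") (auto simp: B Ir0_index mult_right_mono mult_nonpos_nonneg)
    qed
    also have "\<dots> = m * mat_inner n B Y"
      by (subst mat_inner_diagonal[OF cm(3) cY]) (auto simp: B Ir0_index sum_distrib_left)
    finally show "c2 / m \<le> mat_inner n B Y"
      using m by (simp add: field_simps)
  qed
qed

section \<open>Orthogonal diagonalization of a principal block\<close>

text \<open>Orthogonal matrices acting only on the coordinates in the window \<open>{a..<b}\<close>.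
  Keeping the full size \<open>n\<close> lets transformations of different blocks be applied one
  after another without splitting matrices.\<close>

definition orth_on :: "nat \<Rightarrow> nat \<Rightarrow> nat \<Rightarrow> real mat \<Rightarrow> bool" where
  "orth_on n a b T \<longleftrightarrow> T \<in> carrier_mat n n \<and> transpose_mat T * T = 1\<^sub>m n \<and>
    (\<forall>i<n. \<forall>j<n. i \<notin> {a..<b} \<or> j \<notin> {a..<b} \<longrightarrow> T $$ (i, j) = (if i = j then 1 else 0))"

lemma orth_onD:
  assumes "orth_on n a b T"
  shows "T \<in> carrier_mat n n" and "transpose_mat T * T = 1\<^sub>m n"
    and "i < n \<Longrightarrow> j < n \<Longrightarrow> i \<notin> {a..<b} \<or> j \<notin> {a..<b} \<Longrightarrow> T $$ (i, j) = (if i = j then 1 else 0)"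
  using assms by (auto simp: orth_on_def)

lemma orth_on_columns:
  assumes "orth_on n a b T" "i < n" "j < n"
  shows "(\<Sum>k<n. T $$ (k, i) * T $$ (k, j)) = (if i = j then 1 else 0)"
proof -
  have "(transpose_mat T * T) $$ (i, j) = (\<Sum>k<n. T $$ (k, i) * T $$ (k, j))"
    using assms orth_onD(1)[OF assms(1)] by (simp add: scalar_prod_def atLeast0LessThan)
  then show ?thesis using assms by (simp add: orth_onD(2)[OF assms(1)])
qed

lemma orth_onI:
  assumes "T \<in> carrier_mat n n"
    and "\<And>i j. i < n \<Longrightarrow> j < n \<Longrightarrow> (\<Sum>k<n. T $$ (k, i) * T $$ (k, j)) = (if i = j then 1 else 0)"
    and "\<And>i j. i < n \<Longrightarrow> j < n \<Longrightarrow> i \<notin> {a..<b} \<or> j \<notin> {a..<b} \<Longrightarrow> T $$ (i, j) = (if i = j then 1 else 0)"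
  shows "orth_on n a b T"
  unfolding orth_on_def
proof (intro conjI)
  show "transpose_mat T * T = 1\<^sub>m n"
    using assms(1,2) by (intro eq_matI) (auto simp: scalar_prod_def atLeast0LessThan)
qed (use assms in auto)

lemma orth_on_invertible:
  assumes "orth_on n a b T"
  shows "invertible_mat T"
proof -
  note T = orth_onD(1,2)[OF assms]
  have "T * transpose_mat T = 1\<^sub>m n"
    by (rule mat_mult_left_right_inverse[OF _ T(1) T(2)]) (use T in auto)
  then show ?thesis
    using T by (auto simp: invertible_mat_def inverts_mat_def intro!: exI[of _ "transpose_mat T"])
qed

lemma orth_on_one: "orth_on n a b (1\<^sub>m n)"
  by (auto simp: orth_on_def)

lemma orth_on_mono: "orth_on n a b T \<Longrightarrow> a' \<le> a \<Longrightarrow> b \<le> b' \<Longrightarrow> orth_on n a' b' T"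
  by (auto simp: orth_on_def)

lemma orth_on_mult:
  assumes T: "orth_on n a b T" and U: "orth_on n a b U"
  shows "orth_on n a b (T * U)"
  unfolding orth_on_def
proof (intro conjI allI impI)
  note cT = orth_onD(1)[OF T] and cU = orth_onD(1)[OF U]
  show "T * U \<in> carrier_mat n n" using cT cU by simp
  have "transpose_mat (T * U) * (T * U) = mcong (T * U) (1\<^sub>m n)"
    using cT cU by (simp add: mcong_def)
  also have "\<dots> = mcong U (mcong T (1\<^sub>m n))"
    using cT cU by (simp add: mcong_mult)
  also have "\<dots> = 1\<^sub>m n"
    using cT cU orth_onD(2)[OF T] orth_onD(2)[OF U] by (simp add: mcong_def)
  finally show "transpose_mat (T * U) * (T * U) = 1\<^sub>m n" .
  fix i j assume ij: "i < n" "j < n" "i \<notin> {a..<b} \<or> j \<notin> {a..<b}"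
  have e: "(T * U) $$ (i, j) = (\<Sum>k<n. T $$ (i, k) * U $$ (k, j))"
    using ij cT cU by (simp add: scalar_prod_def atLeast0LessThan)
  show "(T * U) $$ (i, j) = (if i = j then 1 else 0)"
  proof (cases "i \<in> {a..<b}")
    case False
    then have "(\<Sum>k<n. T $$ (i, k) * U $$ (k, j)) = (\<Sum>k<n. unit i k * U $$ (k, j))"
      using ij by (intro sum.cong) (auto simp: unit_def orth_onD(3)[OF T])
    then show ?thesis using False ij e orth_onD(3)[OF U, of i j] by (simp add: sum_unit_left)
  next
    case True
    then have "(\<Sum>k<n. T $$ (i, k) * U $$ (k, j)) = (\<Sum>k<n. T $$ (i, k) * unit j k)"
      using ij by (intro sum.cong) (auto simp: unit_def orth_onD(3)[OF U])
    then show ?thesis using True ij e orth_onD(3)[OF T, of i j] by (simp add: sum_unit_right)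
  qed
qed

section \<open>Effect of a windowed orthogonal congruence on entries and blocks\<close>

lemma mcong_orth_on_outside:
  assumes T: "orth_on n a b T" and A: "A \<in> carrier_mat n n"
    and ij: "i < n" "j < n" "i \<notin> {a..<b}" "j \<notin> {a..<b}"
  shows "mcong T A $$ (i, j) = A $$ (i, j)"
proof -
  have "mcong T A $$ (i, j) = qf n A (unit i) (unit j)"
    unfolding mcong_index[OF orth_onD(1)[OF T] A ij(1,2)]
    using ij by (intro qf_cong) (auto simp: unit_def orth_onD(3)[OF T])
  then show ?thesis using ij by (simp add: qf_unit)
qed

lemma mcong_orth_on_mixed_zero:
  assumes T: "orth_on n a b T" and A: "A \<in> carrier_mat n n"
    and ij: "i < n" "j < n" "i \<notin> {a..<b}" "j \<in> {a..<b}"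
    and z: "\<And>k. k < n \<Longrightarrow> k \<in> {a..<b} \<Longrightarrow> A $$ (i, k) = 0"
  shows "mcong T A $$ (i, j) = 0"
proof -
  have "mcong T A $$ (i, j) = qf n A (unit i) (\<lambda>k. T $$ (k, j))"
    unfolding mcong_index[OF orth_onD(1)[OF T] A ij(1,2)]
    using ij by (intro qf_cong) (auto simp: unit_def orth_onD(3)[OF T])
  also have "\<dots> = (\<Sum>k<n. A $$ (i, k) * T $$ (k, j))" using ij by (simp add: qf_unit_left)
  also have "\<dots> = 0"
  proof (rule sum.neutral, rule ballI)
    fix k assume "k \<in> {..<n}"
    then show "A $$ (i, k) * T $$ (k, j) = 0"
      using ij z[of k] orth_onD(3)[OF T, of k j] by (cases "k \<in> {a..<b}") auto
  qed
  finally show ?thesis .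
qed

text \<open>On the window \<open>C\<close> is \<open>\<kappa>\<close> times the identity, and it is
  decoupled from the rest, so it commutes with \<open>T\<close>, and \<open>T^T T\<close> is the
  identity. The cases \<open>\<kappa> = 1\<close> and \<open>\<kappa> = 0\<close> keep
  \<open>B\<close> and the diagonalized \<open>A1\<close> fixed in the reduction.\<close>

lemma mcong_orth_on_scalar_block:
  assumes T: "orth_on n a b T" and C: "C \<in> carrier_mat n n"
    and sc: "\<And>i j. i < n \<Longrightarrow> j < n \<Longrightarrow> i \<in> {a..<b} \<or> j \<in> {a..<b} \<Longrightarrow> C $$ (i, j) = (if i = j then \<kappa> else 0)"
  shows "mcong T C = C"
proof -
  note cT = orth_onD(1)[OF T]
  have "C * T = T * C"
  proof (rule eq_matI)
    fix i j assume "i < dim_row (T * C)" "j < dim_col (T * C)"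
    then have ij: "i < n" "j < n" using cT C by auto
    have "(C * T) $$ (i, j) = (\<Sum>k<n. C $$ (i, k) * T $$ (k, j))"
      using ij cT C by (simp add: scalar_prod_def atLeast0LessThan)
    also have "\<dots> = (\<Sum>k<n. T $$ (i, k) * C $$ (k, j))"
    proof (cases "i \<in> {a..<b}")
      case True
      have "(\<Sum>k<n. C $$ (i, k) * T $$ (k, j)) = (\<Sum>k<n. unit i k * (\<kappa> * T $$ (k, j)))"
        using True ij by (intro sum.cong) (auto simp: unit_def sc)
      also have "\<dots> = \<kappa> * T $$ (i, j)" using ij by (simp add: sum_unit_left)
      also have "\<dots> = (\<Sum>k<n. (T $$ (i, k) * \<kappa>) * unit j k)" using ij by (simp add: sum_unit_right)
      also have "\<dots> = (\<Sum>k<n. T $$ (i, k) * C $$ (k, j))"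
      proof (rule sum.cong[OF refl])
        fix k assume "k \<in> {..<n}"
        then show "T $$ (i, k) * \<kappa> * unit j k = T $$ (i, k) * C $$ (k, j)"
          using ij True orth_onD(3)[OF T, of i k] sc[of k j]
          by (cases "k \<in> {a..<b}") (auto simp: unit_def split: if_splits)
      qed
      finally show ?thesis .
    next
      case i: False
      have "(\<Sum>k<n. T $$ (i, k) * C $$ (k, j)) = (\<Sum>k<n. unit i k * C $$ (k, j))"
        using i ij by (intro sum.cong) (auto simp: unit_def orth_onD(3)[OF T])
      also have "\<dots> = (\<Sum>k<n. C $$ (i, k) * unit j k)" using ij by (simp add: sum_unit_left sum_unit_right)
      also have "\<dots> = (\<Sum>k<n. C $$ (i, k) * T $$ (k, j))"
      proof (rule sum.cong[OF refl])
        fix k assume "k \<in> {..<n}"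
        then show "C $$ (i, k) * unit j k = C $$ (i, k) * T $$ (k, j)"
          using ij i orth_onD(3)[OF T, of k j] sc[of i k]
          by (cases "k \<in> {a..<b}") (auto simp: unit_def)
      qed
      finally show ?thesis by simp
    qed
    also have "\<dots> = (T * C) $$ (i, j)"
      using ij cT C by (simp add: scalar_prod_def atLeast0LessThan)
    finally show "(C * T) $$ (i, j) = (T * C) $$ (i, j)" .
  qed (use cT C in auto)
  moreover have "transpose_mat T * C * T = transpose_mat T * (C * T)"
    by (rule assoc_mult_mat) (use cT C in auto)
  moreover have "transpose_mat T * (T * C) = transpose_mat T * T * C"
    by (rule assoc_mult_mat[symmetric]) (use cT C in auto)
  ultimately show ?thesis using C by (simp add: mcong_def orth_onD(2)[OF T])
qed

text \<open>The Householder reflection \<open>I - \<beta> w w^T\<close> with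
  \<open>w = e_a - u\<close> and \<open>\<beta> |w|^2 = 2\<close> sends \<open>e_a\<close> to
  \<open>u\<close>. It degenerates for \<open>u a = 1\<close>; then \<open>u = e_a\<close>, being a
  unit vector, and the identity serves.\<close>

lemma householder:
  assumes ab: "a < b" "b \<le> n"
    and supp: "\<And>i. i \<notin> {a..<b} \<Longrightarrow> u i = 0"
    and norm: "(\<Sum>i<n. (u i)\<^sup>2) = 1"
  shows "\<exists>H. orth_on n a b H \<and> (\<forall>k<n. H $$ (k, a) = u k)"
proof (cases "u a = 1")
  case True
  have "(\<Sum>i<n. (u i)\<^sup>2) = (u a)\<^sup>2 + (\<Sum>i\<in>{..<n} - {a}. (u i)\<^sup>2)"
    using ab by (intro sum.remove) auto
  then have "(\<Sum>i\<in>{..<n} - {a}. (u i)\<^sup>2) = 0" using True norm by simp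
  then have "\<forall>i\<in>{..<n} - {a}. (u i)\<^sup>2 = 0" by (subst (asm) sum_nonneg_eq_0_iff) auto
  then have "\<forall>k<n. 1\<^sub>m n $$ (k, a) = u k" using True ab by auto
  then show ?thesis using orth_on_one by blast
next
  case False
  define w where "w i = unit a i - u i" for i
  have "(\<Sum>i<n. unit a i * u i) = u a" "(\<Sum>i<n. unit a i * unit a i) = 1"
    using ab by (simp_all add: sum_unit_left) (simp add: unit_def)
  moreover have "(\<Sum>i<n. w i * w i) =
      (\<Sum>i<n. unit a i * unit a i) - 2 * (\<Sum>i<n. unit a i * u i) + (\<Sum>i<n. (u i)\<^sup>2)"
    by (simp add: w_def algebra_simps sum.distrib sum_subtractf power2_eq_square sum_distrib_left)
  ultimately have ww: "(\<Sum>i<n. w i * w i) = 2 * (1 - u a)"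
    using norm by simp
  define \<beta> where "\<beta> = 1 / (1 - u a)"
  have bw: "\<beta> * (\<Sum>i<n. w i * w i) = 2"
    using False by (simp add: ww \<beta>_def field_simps)
  have "w a = 1 - u a" by (simp add: w_def unit_def)
  then have wa: "\<beta> * w a = 1"
    using False by (simp add: \<beta>_def)
  define H where "H = mat n n (\<lambda>(i, j). unit j i - \<beta> * w i * w j)"
  have "orth_on n a b H"
  proof (rule orth_onI)
    show "H \<in> carrier_mat n n" by (simp add: H_def)
    fix i j assume ij: "i < n" "j < n"
    \<comment> \<open>The last term is \<open>2 \<beta> w_i w_j\<close> and cancels the two mixed
      ones.\<close>
    have "(\<Sum>k<n. H $$ (k, i) * H $$ (k, j)) =
      (\<Sum>k<n. unit i k * unit j k) - \<beta> * w j * (\<Sum>k<n. unit i k * w k)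
       - \<beta> * w i * (\<Sum>k<n. w k * unit j k) + \<beta> * w i * w j * (\<beta> * (\<Sum>k<n. w k * w k))"
      using ij by (simp add: H_def algebra_simps sum.distrib sum_subtractf sum_distrib_left)
    also have "\<dots> = unit j i"
      using ij by (simp add: sum_unit_left sum_unit_right bw)
    finally show "(\<Sum>k<n. H $$ (k, i) * H $$ (k, j)) = (if i = j then 1 else 0)"
      by (simp add: unit_def)
  next
    fix i j assume ij: "i < n" "j < n" "i \<notin> {a..<b} \<or> j \<notin> {a..<b}"
    have "w k = 0" if "k \<notin> {a..<b}" for k
      using that ab supp[of k] by (auto simp: w_def unit_def)
    then show "H $$ (i, j) = (if i = j then 1 else 0)"
      using ij by (auto simp: H_def unit_def)
  qed
  moreover have "\<forall>k<n. H $$ (k, a) = u k"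
    using ab wa by (simp add: H_def mult.assoc mult.left_commute[of \<beta>]) (simp add: w_def)
  ultimately show ?thesis by blast
qed

text \<open>A complex eigenvalue exists, and symmetry makes it real. Then the real and imaginary
  parts of a complex eigenvector both satisfy the eigenvector equation, and at least one of them is
  nonzero.\<close>

lemma symmetric_real_eigenvector:
  assumes C: "sym_mat m C" and m: "m > 0"
  obtains u \<mu> i where "i < m" "u i \<noteq> 0"
    and "\<And>k. k < m \<Longrightarrow> (\<Sum>j<m. C $$ (k, j) * u j) = \<mu> * u k"
proof -
  note cC = sym_matD(1)[OF C]
  let ?C = "map_mat complex_of_real C"
  have "?C \<in> carrier_mat m m" using cC by simp
  from spectrum_non_empty[OF this m] obtain e v where v: "eigenvector ?C v e"
    by (auto simp: spectrum_def eigenvalue_def)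
  then have cv: "v \<in> carrier_vec m" and v0: "v \<noteq> 0\<^sub>v m" and ev: "?C *\<^sub>v v = e \<cdot>\<^sub>v v"
    using cC by (auto simp: eigenvector_def)
  have e: "(\<Sum>j<m. complex_of_real (C $$ (k, j)) * v $ j) = e * v $ k" if "k < m" for k
  proof -
    have "(?C *\<^sub>v v) $ k = (\<Sum>j<m. complex_of_real (C $$ (k, j)) * v $ j)"
      using that cC cv by (simp add: scalar_prod_def atLeast0LessThan)
    then show ?thesis using that cv by (simp add: ev)
  qed
  define x where "x j = Re (v $ j)" for j
  define y where "y j = Im (v $ j)" for j
  have ex: "(\<Sum>j<m. C $$ (k, j) * x j) = Re e * x k - Im e * y k" if "k < m" for k
    using arg_cong[OF e[OF that], of Re] by (simp add: x_def y_def)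
  have ey: "(\<Sum>j<m. C $$ (k, j) * y j) = Re e * y k + Im e * x k" if "k < m" for k
    using arg_cong[OF e[OF that], of Im] by (simp add: x_def y_def)
  \<comment> \<open>The bilinear form takes the same value at \<open>(x, y)\<close> and
    \<open>(y, x)\<close>; computed through the eigenvector equations, the difference is
    \<open>Im e\<close> times the squared norm of \<open>v\<close>.\<close>
  have "qf m C y x = (\<Sum>k<m. y k * (Re e * x k - Im e * y k))"
    unfolding qf_def by (intro sum.cong refl) (simp add: mult.assoc flip: sum_distrib_left ex)
  moreover have "qf m C x y = (\<Sum>k<m. x k * (Re e * y k + Im e * x k))"
    unfolding qf_def by (intro sum.cong refl) (simp add: mult.assoc flip: sum_distrib_left ey)
  ultimately have "(\<Sum>k<m. x k * (Re e * y k + Im e * x k) - y k * (Re e * x k - Im e * y k)) = 0"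
    using qf_commute[OF C, of x y] by (simp add: sum_subtractf)
  then have "Im e * (\<Sum>k<m. (x k)\<^sup>2 + (y k)\<^sup>2) = 0"
    by (simp add: sum_distrib_left algebra_simps power2_eq_square)
  moreover obtain i where i: "i < m" "v $ i \<noteq> 0"
    using v0 cv by (metis carrier_vecD eq_vecI index_zero_vec)
  then have xy: "x i \<noteq> 0 \<or> y i \<noteq> 0" by (auto simp: x_def y_def complex_eq_iff)
  then have "0 < (\<Sum>k<m. (x k)\<^sup>2 + (y k)\<^sup>2)"
    using i by (intro sum_pos2[of _ i]) (auto simp: sum_power2_gt_zero_iff)
  ultimately have "Im e = 0" by simp
  then show ?thesis
    using that[of i x "Re e"] that[of i y "Re e"] i xy ex ey by auto
qed

text \<open>A unit eigenvector of the principal block, extended by zero. The eigenvector equation is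
  restricted to rows of the window, since the other rows of \<open>A\<close> are arbitrary.\<close>

lemma symmetric_block_eigenvector:
  assumes A: "sym_mat n A" and ab: "a < b" "b \<le> n"
  obtains u \<mu> where "\<And>i. i \<notin> {a..<b} \<Longrightarrow> u i = 0" "(\<Sum>i<n. (u i)\<^sup>2) = 1"
    "\<And>k. k \<in> {a..<b} \<Longrightarrow> (\<Sum>j<n. A $$ (k, j) * u j) = \<mu> * u k"
proof -
  let ?C = "mat (b - a) (b - a) (\<lambda>(i, j). A $$ (a + i, a + j))"
  have C: "sym_mat (b - a) ?C"
    using ab by (intro sym_matI) (auto intro: sym_matD(4)[OF A])
  have "0 < b - a" using ab by simp
  obtain u \<mu> i where u: "i < b - a" "u i \<noteq> 0"
    "\<And>k. k < b - a \<Longrightarrow> (\<Sum>j<b - a. ?C $$ (k, j) * u j) = \<mu> * u k"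
    by (rule symmetric_real_eigenvector[OF C \<open>0 < b - a\<close>]) (rule that)
  define w where "w k = (if k \<in> {a..<b} then u (k - a) else 0)" for k
  have shift: "(\<Sum>j<n. f j * w j) = (\<Sum>j<b - a. f (a + j) * u j)" for f :: "nat \<Rightarrow> real"
  proof -
    have "(\<Sum>j<n. f j * w j) = (\<Sum>j\<in>{a..<b}. f j * w j)"
      using ab by (intro sum.mono_neutral_right) (auto simp: w_def)
    also have "\<dots> = (\<Sum>j<b - a. f (a + j) * w (a + j))"
      by (rule sum.reindex_bij_witness[of _ "\<lambda>j. a + j" "\<lambda>j. j - a"]) auto
    also have "\<dots> = (\<Sum>j<b - a. f (a + j) * u j)"
      by (intro sum.cong) (auto simp: w_def)
    finally show ?thesis .
  qed
  have ew: "(\<Sum>j<n. A $$ (k, j) * w j) = \<mu> * w k" if "k \<in> {a..<b}" for k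
  proof -
    have "k - a < b - a" "a + (k - a) = k" using that by auto
    then show ?thesis using u(3)[of "k - a"] that by (simp add: shift) (simp add: w_def)
  qed
  define N where "N = (\<Sum>i<n. (w i)\<^sup>2)"
  have "a + i < n" "w (a + i) \<noteq> 0" using u ab by (auto simp: w_def)
  then have N: "N > 0" unfolding N_def by (intro sum_pos2[of _ "a + i"]) auto
  show ?thesis
  proof (rule that[of "\<lambda>i. w i / sqrt N" \<mu>])
    show "w i / sqrt N = 0" if "i \<notin> {a..<b}" for i using that by (auto simp: w_def)
    show "(\<Sum>i<n. (w i / sqrt N)\<^sup>2) = 1"
      using N by (simp add: power_divide flip: sum_divide_distrib N_def)
    show "(\<Sum>j<n. A $$ (k, j) * (w j / sqrt N)) = \<mu> * (w k / sqrt N)" if "k \<in> {a..<b}" for k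
      using ew[OF that] by (simp flip: sum_divide_distrib)
  qed
qed

text \<open>Deflation: a reflection makes a unit eigenvector of the block the column
  \<open>a\<close>, which clears row \<open>a\<close> inside the window; the induction hypothesis
  then handles the window shortened by \<open>a\<close> and leaves the cleared row zero.\<close>

lemma orth_diagonalization:
  assumes "sym_mat n A" "b \<le> n"
  shows "\<exists>T. orth_on n a b T \<and>
    (\<forall>i\<in>{a..<b}. \<forall>j\<in>{a..<b}. i \<noteq> j \<longrightarrow> mcong T A $$ (i, j) = 0)"
  using assms
proof (induction "b - a" arbitrary: a A)
  case 0
  then show ?case by (intro exI[of _ "1\<^sub>m n"]) (auto simp: orth_on_one)
next
  case (Suc d)
  then have ab: "a < b" by simp
  note cA = sym_matD(1)[OF Suc(3)]
  obtain u \<mu> where u: "\<And>i. i \<notin> {a..<b} \<Longrightarrow> u i = 0" "(\<Sum>i<n. (u i)\<^sup>2) = 1"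
    "\<And>k. k \<in> {a..<b} \<Longrightarrow> (\<Sum>j<n. A $$ (k, j) * u j) = \<mu> * u k"
    using symmetric_block_eigenvector[OF Suc(3) ab Suc(4)] by blast
  obtain H where H: "orth_on n a b H" "\<And>k. k < n \<Longrightarrow> H $$ (k, a) = u k"
    using householder[OF ab Suc(4) u(1,2)] by blast
  note cH = orth_onD(1)[OF H(1)]
  let ?A = "mcong H A"
  have sA: "sym_mat n ?A" by (rule mcong_sym[OF cH Suc(3)])
  have "d = b - Suc a" using Suc(2) by simp
  from Suc(1)[OF this sA Suc(4)] obtain U where U: "orth_on n (Suc a) b U"
    "\<And>i j. i \<in> {Suc a..<b} \<Longrightarrow> j \<in> {Suc a..<b} \<Longrightarrow> i \<noteq> j \<Longrightarrow> mcong U ?A $$ (i, j) = 0"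
    by blast
  \<comment> \<open>Entry \<open>(a, k)\<close> pairs column \<open>k\<close> of \<open>H\<close>
    with \<open>A u\<close>. On the window \<open>A u\<close> equals \<open>\<mu> u\<close>, outside
    it column \<open>k\<close> vanishes, and columns \<open>a\<close> and \<open>k\<close> are
    orthogonal.\<close>
  have row: "?A $$ (a, k) = 0" if "k < n" "k \<in> {Suc a..<b}" for k
  proof -
    have "?A $$ (a, k) = qf n A (\<lambda>l. H $$ (l, k)) u"
      using mcong_index[OF cH cA, of a k] H(2) that qf_commute[OF Suc(3)] by (simp cong: qf_cong)
    also have "\<dots> = (\<Sum>l<n. H $$ (l, k) * (\<mu> * H $$ (l, a)))"
      unfolding qf_def
    proof (rule sum.cong[OF refl])
      fix l assume l: "l \<in> {..<n}"
      have "(\<Sum>j<n. H $$ (l, k) * A $$ (l, j) * u j) = H $$ (l, k) * (\<Sum>j<n. A $$ (l, j) * u j)"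
        by (simp add: sum_distrib_left mult.assoc)
      also have "\<dots> = H $$ (l, k) * (\<mu> * H $$ (l, a))"
      proof (cases "l \<in> {a..<b}")
        case True
        then show ?thesis using u(3)[OF True] H(2) l by simp
      next
        case False
        then have "H $$ (l, k) = 0" using orth_onD(3)[OF H(1), of l k] l that by auto
        then show ?thesis by simp
      qed
      finally show "(\<Sum>j<n. H $$ (l, k) * A $$ (l, j) * u j) = H $$ (l, k) * (\<mu> * H $$ (l, a))" .
    qed
    also have "\<dots> = \<mu> * (\<Sum>l<n. H $$ (l, k) * H $$ (l, a))"
      by (simp add: sum_distrib_left mult_ac)
    also have "\<dots> = 0" using that ab Suc(4) by (simp add: orth_on_columns[OF H(1)])
    finally show ?thesis .
  qed
  have row': "mcong U ?A $$ (a, k) = 0" if "k \<in> {Suc a..<b}" for k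
    by (rule mcong_orth_on_mixed_zero[OF U(1) sym_matD(1)[OF sA]]) (use that ab Suc(4) row in auto)
  have sU: "sym_mat n (mcong U ?A)" by (rule mcong_sym[OF orth_onD(1)[OF U(1)] sA])
  show ?case
  proof (intro exI[of _ "H * U"] conjI ballI impI)
    show "orth_on n a b (H * U)"
      by (rule orth_on_mult[OF H(1) orth_on_mono[OF U(1)]]) auto
    fix i j assume ij: "i \<in> {a..<b}" "j \<in> {a..<b}" "i \<noteq> j"
    have "mcong U ?A $$ (i, j) = 0"
    proof (cases "i = a")
      case True
      then show ?thesis using ij row'[of j] by auto
    next
      case False
      then show ?thesis using ij row'[of i] U(2)[of i j] sym_matD(4)[OF sU, of i j] Suc(4) by (cases "j = a") auto
    qed
    then show "mcong (H * U) A $$ (i, j) = 0"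
      by (simp add: mcong_mult[OF cH orth_onD(1)[OF U(1)] cA])
  qed
qed

text \<open>Two bijections are glued, one onto the indices satisfying \<open>R\<close> and one onto
  the others. This sorts eigenvalues by sign so that they occupy consecutive blocks.\<close>

lemma permutation_partition:
  fixes a b :: nat
  assumes "a \<le> b"
  shows "\<exists>\<pi> p. \<pi> permutes {a..<b} \<and> a \<le> p \<and> p \<le> b \<and> (\<forall>i\<in>{a..<b}. R (\<pi> i) \<longleftrightarrow> i < p)"
proof -
  define S where "S = {i\<in>{a..<b}. R i}"
  define p where "p = a + card S"
  have S: "S \<subseteq> {a..<b}" "finite S" by (auto simp: S_def)
  have cS: "card S \<le> b - a" using card_mono[OF _ S(1)] by simp
  obtain f where f: "bij_betw f {a..<p} S"
    using finite_same_card_bij[of "{a..<p}" S] S by (auto simp: p_def)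
  obtain g where g: "bij_betw g {p..<b} ({a..<b} - S)"
    using finite_same_card_bij[of "{p..<b}" "{a..<b} - S"] S cS
    by (auto simp: p_def card_Diff_subset)
  define \<pi> where "\<pi> i = (if i \<in> {a..<p} then f i else if i \<in> {p..<b} then g i else i)" for i
  have "bij_betw \<pi> {a..<p} S" using f by (subst bij_betw_cong[of _ _ f]) (auto simp: \<pi>_def)
  moreover have "bij_betw \<pi> {p..<b} ({a..<b} - S)" using g by (subst bij_betw_cong[of _ _ g]) (auto simp: \<pi>_def)
  ultimately have "bij_betw \<pi> ({a..<p} \<union> {p..<b}) (S \<union> ({a..<b} - S))"
    by (rule bij_betw_combine) auto
  moreover have "{a..<p} \<union> {p..<b} = {a..<b}" using cS assms by (auto simp: p_def)
  moreover have "S \<union> ({a..<b} - S) = {a..<b}" using S by auto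
  ultimately have "bij_betw \<pi> {a..<b} {a..<b}" by simp
  then have "\<pi> permutes {a..<b}"
    by (rule bij_imp_permutes) (use cS assms in \<open>auto simp: \<pi>_def p_def\<close>)
  moreover have "R (\<pi> i) \<longleftrightarrow> i < p" if i: "i \<in> {a..<b}" for i
  proof (cases "i < p")
    case True
    then have "\<pi> i \<in> S" using i bij_betw_apply[OF f, of i] by (auto simp: \<pi>_def)
    then show ?thesis using True by (simp add: S_def)
  next
    case False
    then have "\<pi> i \<in> {a..<b} - S" using i bij_betw_apply[OF g, of i] by (auto simp: \<pi>_def)
    then show ?thesis using False by (auto simp: S_def)
  qed
  ultimately show ?thesis using cS assms by (intro exI[of _ \<pi>] exI[of _ p]) (auto simp: p_def)
qed

text \<open>Diagonalization followed by a permutation matrix. With positivity for \<open>R\<close>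
  the split point delimits \<open>\<Lambda>\<close>; with negativity it delimits the block that
  becomes \<open>-I_s\<close>.\<close>

lemma sorted_orth_diagonalization:
  assumes A: "sym_mat n A" and ab: "a \<le> b" "b \<le> n"
  obtains T p where "orth_on n a b T" "a \<le> p" "p \<le> b"
    "\<And>i j. i \<in> {a..<b} \<Longrightarrow> j \<in> {a..<b} \<Longrightarrow> i \<noteq> j \<Longrightarrow> mcong T A $$ (i, j) = 0"
    "\<And>i. i \<in> {a..<b} \<Longrightarrow> R (mcong T A $$ (i, i)) \<longleftrightarrow> i < p"
proof -
  note cA = sym_matD(1)[OF A]
  from orth_diagonalization[OF A ab(2)] obtain T where T: "orth_on n a b T"
    "\<And>i j. i \<in> {a..<b} \<Longrightarrow> j \<in> {a..<b} \<Longrightarrow> i \<noteq> j \<Longrightarrow> mcong T A $$ (i, j) = 0"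
    by blast
  obtain \<pi> p where \<pi>: "\<pi> permutes {a..<b}" and p: "a \<le> p" "p \<le> b"
    and R: "\<And>i. i \<in> {a..<b} \<Longrightarrow> R (mcong T A $$ (\<pi> i, \<pi> i)) \<longleftrightarrow> i < p"
    using permutation_partition[OF ab(1), of "\<lambda>i. R (mcong T A $$ (i, i))"] by blast
  have \<pi>n: "\<pi> i < n" if "i < n" for i
    using permutes_in_image[OF \<pi>, of i] permutes_not_in[OF \<pi>, of i] that ab
    by (cases "i \<in> {a..<b}") auto
  have inj: "\<pi> i = \<pi> j \<longleftrightarrow> i = j" for i j using permutes_inj[OF \<pi>] by (auto dest: injD)
  \<comment> \<open>Column \<open>j\<close> is \<open>e_{\<pi> j}\<close>, so congruence by
    \<open>P\<close> relabels both indices of an entry by \<open>\<pi>\<close>.\<close>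
  define P where "P = mat n n (\<lambda>(i, j). unit (\<pi> j) i)"
  have P: "orth_on n a b P"
  proof (rule orth_onI)
    show "P \<in> carrier_mat n n" by (simp add: P_def)
    fix i j assume ij: "i < n" "j < n"
    then have "(\<Sum>k<n. P $$ (k, i) * P $$ (k, j)) = unit (\<pi> j) (\<pi> i)"
      using \<pi>n by (simp add: P_def sum_unit_left)
    then show "(\<Sum>k<n. P $$ (k, i) * P $$ (k, j)) = (if i = j then 1 else 0)"
      by (simp add: unit_def inj)
  next
    fix i j assume ij: "i < n" "j < n" "i \<notin> {a..<b} \<or> j \<notin> {a..<b}"
    have "i = \<pi> j \<longleftrightarrow> i = j"
      using ij permutes_in_image[OF \<pi>, of j] permutes_not_in[OF \<pi>, of j] by (cases "j \<in> {a..<b}") auto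
    then show "P $$ (i, j) = (if i = j then 1 else 0)"
      using ij by (simp add: P_def unit_def)
  qed
  have e: "mcong (T * P) A $$ (i, j) = mcong T A $$ (\<pi> i, \<pi> j)" if "i < n" "j < n" for i j
  proof -
    have "mcong (T * P) A $$ (i, j) = qf n (mcong T A) (unit (\<pi> i)) (unit (\<pi> j))"
      unfolding mcong_mult[OF orth_onD(1)[OF T(1)] orth_onD(1)[OF P] cA, symmetric]
        mcong_index[OF orth_onD(1)[OF P] mcong_carrier[OF orth_onD(1)[OF T(1)] cA] that]
      using that by (intro qf_cong) (auto simp: P_def)
    then show ?thesis using \<pi>n that by (simp add: qf_unit)
  qed
  show ?thesis
  proof (rule that[OF orth_on_mult[OF T(1) P] p])
    fix i j assume ij: "i \<in> {a..<b}" "j \<in> {a..<b}" "i \<noteq> j"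
    then have "\<pi> i \<in> {a..<b}" "\<pi> j \<in> {a..<b}" "\<pi> i \<noteq> \<pi> j"
      by (simp_all only: permutes_in_image[OF \<pi>] inj not_False_eq_True)
    then show "mcong (T * P) A $$ (i, j) = 0" using T(2) e ij ab by simp
  next
    fix i assume "i \<in> {a..<b}"
    then show "R (mcong (T * P) A $$ (i, i)) \<longleftrightarrow> i < p" using R e ab by simp
  qed
qed

section \<open>Consequences of a gap\<close>

text \<open>The shape \<open>\<Lambda> \<oplus> 0\<close> required of the first matrix in the normal
  form.\<close>

definition head_diag :: "nat \<Rightarrow> nat \<Rightarrow> real mat \<Rightarrow> bool" where
  "head_diag n p A \<longleftrightarrow> sym_mat n A \<and> p \<le> n \<and>
    (\<forall>i<n. \<forall>j<n. i \<noteq> j \<or> p \<le> i \<longrightarrow> A $$ (i, j) = 0) \<and> (\<forall>i<p. 0 < A $$ (i, i))"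

lemma head_diagD:
  assumes "head_diag n p A"
  shows "sym_mat n A" and "p \<le> n"
    and "i < n \<Longrightarrow> j < n \<Longrightarrow> i \<noteq> j \<or> p \<le> i \<Longrightarrow> A $$ (i, j) = 0"
    and "i < p \<Longrightarrow> 0 < A $$ (i, i)"
  using assms unfolding head_diag_def by blast+

lemma sum_lessThan_split:
  fixes f :: "nat \<Rightarrow> real"
  assumes "p \<le> n"
  shows "(\<Sum>i<n. f i) = (\<Sum>i<p. f i) + (\<Sum>i\<in>{p..<n}. f i)"
  using sum.atLeastLessThan_concat[of 0 p n f] assms by (simp add: lessThan_atLeast0)

lemma qf_head_diag:
  assumes "head_diag n p A"
  shows "qf n A v v = (\<Sum>i<p. A $$ (i, i) * (v i)\<^sup>2)"
proof -
  have "qf n A v v = (\<Sum>i<n. A $$ (i, i) * (v i)\<^sup>2)"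
    by (rule qf_diagonal) (rule head_diagD(3)[OF assms], auto)
  also have "\<dots> = (\<Sum>i<p. A $$ (i, i) * (v i)\<^sup>2) + (\<Sum>i\<in>{p..<n}. A $$ (i, i) * (v i)\<^sup>2)"
    by (rule sum_lessThan_split[OF head_diagD(2)[OF assms]])
  also have "(\<Sum>i\<in>{p..<n}. A $$ (i, i) * (v i)\<^sup>2) = 0"
    by (rule sum.neutral) (auto simp: head_diagD(3)[OF assms])
  finally show ?thesis by simp
qed

text \<open>If \<open>w\<close> vanishes on the first \<open>p\<close> coordinates,
  \<open>w w^T\<close> is orthogonal to \<open>A1\<close>; when the form of \<open>A2\<close> is
  positive at \<open>w\<close>, scaling makes it dual feasible and its value is at least
  \<open>\<beta>\<close>. In the other case the inequality holds by signs. So the dual bound becomes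
  an inequality of forms.\<close>

lemma gap_bounds:
  assumes A1: "head_diag n p A1" and A2: "sym_mat n A2" and c2: "c2 > 0"
    and gap: "has_gap n (A1, A2, Ir0 n r, 0, c2)"
  obtains \<alpha> \<beta> where "0 \<le> \<alpha>" "\<alpha> < \<beta>"
    "\<And>x1 x2. primal_feasible n A1 A2 (Ir0 n r) x1 x2 \<Longrightarrow> c2 * x2 \<le> \<alpha>"
    "\<And>w. (\<And>k. k < p \<Longrightarrow> w k = 0) \<Longrightarrow> \<beta> * qf n A2 w w \<le> c2 * qf n (Ir0 n r) w w"
proof -
  have B: "psd n (Ir0 n r)" by (rule psd_Ir0)
  then have sB: "sym_mat n (Ir0 n r)" by (simp add: psd_def)
  note s = head_diagD(1)[OF A1] A2 sB
  note c = s[THEN sym_matD(1)]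
  from gap obtain \<alpha> \<beta> where ab: "\<alpha> < \<beta>"
    and P: "\<And>x1 x2. primal_feasible n A1 A2 (Ir0 n r) x1 x2 \<Longrightarrow> 0 * x1 + c2 * x2 \<le> \<alpha>"
    and D: "\<And>Y. psd n Y \<Longrightarrow> mat_inner n A1 Y = 0 \<Longrightarrow> mat_inner n A2 Y = c2 \<Longrightarrow>
      \<beta> \<le> mat_inner n (Ir0 n r) Y"
    by (rule has_gapE) (rule that)
  have a0: "0 \<le> \<alpha>" using P[of 0 0] B by (simp add: primal_feasible_iff[OF s] psd_iff_qf)
  show ?thesis
  proof (rule that[OF a0 ab])
    show "c2 * x2 \<le> \<alpha>" if "primal_feasible n A1 A2 (Ir0 n r) x1 x2" for x1 x2
      using P[OF that] by simp
    fix w :: "nat \<Rightarrow> real" assume w: "\<And>k. k < p \<Longrightarrow> w k = 0"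
    show "\<beta> * qf n A2 w w \<le> c2 * qf n (Ir0 n r) w w"
    proof (cases "qf n A2 w w > 0")
      case True
      let ?Y = "rank_one n (c2 / qf n A2 w w) w"
      have "\<beta> \<le> mat_inner n (Ir0 n r) ?Y"
      proof (rule D)
        show "psd n ?Y" using True c2 by (intro psd_rank_one) simp
        show "mat_inner n A1 ?Y = 0"
          using w by (simp add: mat_inner_rank_one c qf_head_diag[OF A1])
        show "mat_inner n A2 ?Y = c2" using True by (simp add: mat_inner_rank_one c)
      qed
      then show ?thesis using True by (simp add: mat_inner_rank_one field_simps)
    next
      case False
      then have "\<beta> * qf n A2 w w \<le> 0" using ab a0 by (simp add: mult_le_0_iff)
      also have "0 \<le> c2 * qf n (Ir0 n r) w w" using c2 B by (simp add: psd_iff_qf)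
      finally show ?thesis .
    qed
  qed
qed

text \<open>The form inequality from the gap is tested at \<open>e_j\<close>, where \<open>B\<close>
  vanishes, and at \<open>e_i + s e_j\<close>, where \<open>B\<close> contributes the constant 1 and
  \<open>A2_jj = 0\<close> leaves an affine function of \<open>s\<close>.\<close>

lemma gap_imp_tail_nonpos:
  assumes A1: "head_diag n p A1" and A2: "sym_mat n A2" and c2: "c2 > 0"
    and gap: "has_gap n (A1, A2, Ir0 n r, 0, c2)"
    and p: "p \<le> r" and j: "r \<le> j" "j < n"
  shows "A2 $$ (j, j) \<le> 0"
    and "A2 $$ (j, j) = 0 \<Longrightarrow> p \<le> i \<Longrightarrow> i < r \<Longrightarrow> A2 $$ (i, j) = 0"
proof -
  obtain \<alpha> \<beta> where ab: "0 \<le> \<alpha>" "\<alpha> < \<beta>" and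
    D: "\<And>w. (\<And>k. k < p \<Longrightarrow> w k = 0) \<Longrightarrow> \<beta> * qf n A2 w w \<le> c2 * qf n (Ir0 n r) w w"
    using gap_bounds[OF A1 A2 c2 gap] by metis
  have b: "\<beta> > 0" using ab by simp
  show "A2 $$ (j, j) \<le> 0"
    using D[of "unit j"] p j b by (simp add: qf_unit Ir0_index unit_def[of j] mult_le_0_iff)
  assume z: "A2 $$ (j, j) = 0" and i: "p \<le> i" "i < r"
  have "\<beta> * A2 $$ (i, i) + s * (2 * \<beta> * A2 $$ (i, j)) \<le> c2" for s
  proof -
    let ?w = "\<lambda>k. unit i k + s * unit j k"
    have "\<beta> * qf n A2 ?w ?w \<le> c2 * qf n (Ir0 n r) ?w ?w"
      by (rule D) (use i p j in \<open>simp add: unit_def\<close>)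
    then show ?thesis
      using i j z sym_matD(4)[OF A2, of i j]
      by (simp add: qf_linear qf_unit Ir0_index algebra_simps)
  qed
  from affine_nonpos_imp_slope_zero[OF this] show "A2 $$ (i, j) = 0" using b by simp
qed

text \<open>Completing the square in each tail coordinate with a positive pivot bounds the mixed
  terms by a multiple of the squared norm of the first \<open>p\<close> coordinates, zero columns
  contribute nothing, and a large multiple of the positive definite head of \<open>A\<close> absorbs
  the loss.\<close>

lemma penalty_psd:
  assumes S: "sym_mat n S" and A: "head_diag n p A"
    and off: "\<And>i j. p \<le> i \<Longrightarrow> i < n \<Longrightarrow> p \<le> j \<Longrightarrow> j < n \<Longrightarrow> i \<noteq> j \<Longrightarrow> S $$ (i, j) = 0"
    and diag: "\<And>j. p \<le> j \<Longrightarrow> j < n \<Longrightarrow> 0 < S $$ (j, j) \<or> (\<forall>i<n. S $$ (i, j) = 0)"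
  obtains K where "\<And>v. 0 \<le> qf n S v v + K * qf n A v v"
proof -
  note p = head_diagD(2)[OF A] and pos = head_diagD(4)[OF A]
  define a where "a = (\<Sum>i<p. \<Sum>j<p. \<bar>S $$ (i, j)\<bar>)"
  \<comment> \<open>The loss from completing the square, after Cauchy-Schwarz. For a zero column the
    division by zero yields 0, the correct value there.\<close>
  define b where "b j = (\<Sum>i<p. (S $$ (i, j))\<^sup>2) / S $$ (j, j)" for j
  define C where "C = a + (\<Sum>j\<in>{p..<n}. b j)"
  have a0: "0 \<le> a" unfolding a_def by (intro sum_nonneg) auto
  have b0: "0 \<le> b j" if "j \<in> {p..<n}" for j
    unfolding b_def using that diag[of j] by (auto intro!: divide_nonneg_nonneg sum_nonneg)
  have C0: "0 \<le> C" unfolding C_def using a0 b0 by (intro add_nonneg_nonneg sum_nonneg) auto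
  \<comment> \<open>The sum stands in for the maximum of \<open>C / A_ii\<close> and also covers
    \<open>p = 0\<close>.\<close>
  define K where "K = (\<Sum>i<p. C / A $$ (i, i))"
  have K: "C \<le> K * A $$ (i, i)" if "i < p" for i
  proof -
    have "C / A $$ (i, i) \<le> K"
      unfolding K_def using that C0 pos by (intro member_le_sum) (auto intro!: divide_nonneg_pos)
    then show ?thesis using pos[OF that] by (simp add: field_simps)
  qed
  have "0 \<le> qf n S v v + K * qf n A v v" for v
  proof -
    define N where "N = (\<Sum>i<p. (v i)\<^sup>2)"
    define l where "l j = (\<Sum>i<p. S $$ (i, j) * v i)" for j
    have vN: "(v i)\<^sup>2 \<le> N" if "i < p" for i
      unfolding N_def using that by (intro member_le_sum) auto
    have part1: "- (a * N) \<le> (\<Sum>i<p. \<Sum>j<p. v i * S $$ (i, j) * v j)"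
      unfolding a_def sum_distrib_right sum_negf[symmetric]
    proof (intro sum_mono)
      fix i j assume "i \<in> {..<p}" "j \<in> {..<p}"
      then have "(v i)\<^sup>2 \<le> N" "(v j)\<^sup>2 \<le> N" using vN by auto
      moreover have "2 * \<bar>v i * v j\<bar> \<le> (v i)\<^sup>2 + (v j)\<^sup>2"
        using sum_squares_bound[of "\<bar>v i\<bar>" "\<bar>v j\<bar>"] by (simp add: abs_mult)
      ultimately have "\<bar>v i * v j\<bar> \<le> N" by linarith
      then have "\<bar>S $$ (i, j)\<bar> * \<bar>v i * v j\<bar> \<le> \<bar>S $$ (i, j)\<bar> * N"
        by (rule mult_left_mono) simp
      then have "\<bar>v i * S $$ (i, j) * v j\<bar> \<le> \<bar>S $$ (i, j)\<bar> * N"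
        by (simp add: abs_mult mult_ac)
      then show "- (\<bar>S $$ (i, j)\<bar> * N) \<le> v i * S $$ (i, j) * v j" by linarith
    qed
    have part2: "- (b j * N) \<le> 2 * l j * v j + S $$ (j, j) * (v j)\<^sup>2" if j: "j \<in> {p..<n}" for j
    proof (cases "0 < S $$ (j, j)")
      case True
      have "(l j)\<^sup>2 \<le> (\<Sum>i<p. (S $$ (i, j))\<^sup>2) * N"
        unfolding l_def N_def by (rule Cauchy_Schwarz_ineq_sum)
      then have "(l j)\<^sup>2 / S $$ (j, j) \<le> b j * N"
        using True by (simp add: b_def divide_right_mono)
      moreover have "2 * l j * v j + S $$ (j, j) * (v j)\<^sup>2 =
          S $$ (j, j) * (v j + l j / S $$ (j, j))\<^sup>2 - (l j)\<^sup>2 / S $$ (j, j)"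
        using True by (simp add: field_simps power2_eq_square)
      moreover have "0 \<le> S $$ (j, j) * (v j + l j / S $$ (j, j))\<^sup>2" using True by simp
      ultimately show ?thesis by linarith
    next
      case False
      then have "\<forall>i<n. S $$ (i, j) = 0" using diag[of j] j by auto
      then have "l j = 0" "S $$ (j, j) = 0" using p j by (auto simp: l_def)
      then show ?thesis by (simp add: b_def)
    qed
    \<comment> \<open>Splitting into head and tail gives four blocks: the two mixed ones agree by
      symmetry, and the tail block is diagonal.\<close>
    have "qf n S v v =
        (\<Sum>i<p. (\<Sum>j<p. v i * S $$ (i, j) * v j) + (\<Sum>j\<in>{p..<n}. v i * S $$ (i, j) * v j)) +
        (\<Sum>i\<in>{p..<n}. (\<Sum>j<p. v i * S $$ (i, j) * v j) + (\<Sum>j\<in>{p..<n}. v i * S $$ (i, j) * v j))"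
      unfolding qf_def sum_lessThan_split[OF p] ..
    also have "\<dots> = (\<Sum>i<p. \<Sum>j<p. v i * S $$ (i, j) * v j) +
        (\<Sum>i<p. \<Sum>j\<in>{p..<n}. v i * S $$ (i, j) * v j) +
        (\<Sum>i\<in>{p..<n}. \<Sum>j<p. v i * S $$ (i, j) * v j) +
        (\<Sum>i\<in>{p..<n}. \<Sum>j\<in>{p..<n}. v i * S $$ (i, j) * v j)"
      by (simp add: sum.distrib)
    also have "(\<Sum>i<p. \<Sum>j\<in>{p..<n}. v i * S $$ (i, j) * v j) = (\<Sum>j\<in>{p..<n}. l j * v j)"
      by (subst sum.swap) (simp add: l_def sum_distrib_left mult_ac)
    also have "(\<Sum>i\<in>{p..<n}. \<Sum>j<p. v i * S $$ (i, j) * v j) = (\<Sum>j\<in>{p..<n}. l j * v j)"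
    proof (rule sum.cong[OF refl])
      fix i assume "i \<in> {p..<n}"
      then have "(\<Sum>j<p. v i * S $$ (i, j) * v j) = (\<Sum>j<p. S $$ (j, i) * v j * v i)"
        using p by (intro sum.cong) (auto simp: sym_matD(4)[OF S, of i])
      then show "(\<Sum>j<p. v i * S $$ (i, j) * v j) = l i * v i"
        by (simp add: l_def sum_distrib_right)
    qed
    also have "(\<Sum>i\<in>{p..<n}. \<Sum>j\<in>{p..<n}. v i * S $$ (i, j) * v j) =
        (\<Sum>i\<in>{p..<n}. S $$ (i, i) * (v i)\<^sup>2)"
    proof (rule sum.cong[OF refl])
      fix i assume i: "i \<in> {p..<n}"
      then have "(\<Sum>j\<in>{p..<n}. v i * S $$ (i, j) * v j) = (\<Sum>j\<in>{i}. v i * S $$ (i, j) * v j)"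
        by (intro sum.mono_neutral_right) (auto simp: off)
      then show "(\<Sum>j\<in>{p..<n}. v i * S $$ (i, j) * v j) = S $$ (i, i) * (v i)\<^sup>2"
        by (simp add: power2_eq_square mult_ac)
    qed
    finally have "qf n S v v = (\<Sum>i<p. \<Sum>j<p. v i * S $$ (i, j) * v j) +
        (\<Sum>j\<in>{p..<n}. 2 * l j * v j + S $$ (j, j) * (v j)\<^sup>2)"
      by (simp add: sum.distrib mult.assoc flip: sum_distrib_left)
    moreover have "(\<Sum>j\<in>{p..<n}. - (b j * N)) \<le> (\<Sum>j\<in>{p..<n}. 2 * l j * v j + S $$ (j, j) * (v j)\<^sup>2)"
      by (intro sum_mono part2)
    moreover have "(\<Sum>j\<in>{p..<n}. - (b j * N)) = - ((\<Sum>j\<in>{p..<n}. b j) * N)"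
      by (simp add: sum_negf sum_distrib_right)
    moreover have "C * N \<le> K * qf n A v v"
    proof -
      have "C * N = (\<Sum>i<p. C * (v i)\<^sup>2)" by (simp add: N_def sum_distrib_left)
      also have "\<dots> \<le> (\<Sum>i<p. K * A $$ (i, i) * (v i)\<^sup>2)"
        using K by (intro sum_mono mult_right_mono) auto
      also have "\<dots> = K * qf n A v v"
        by (simp add: qf_head_diag[OF A] sum_distrib_left mult.assoc)
      finally show ?thesis .
    qed
    moreover have "C * N = a * N + (\<Sum>j\<in>{p..<n}. b j) * N" by (simp add: C_def distrib_right)
    ultimately show ?thesis using part1 by linarith
  qed
  then show ?thesis by (rule that)
qed

text \<open>If the corner were zero, the slack at \<open>x1 = 0\<close>,
  \<open>c2 * x2 = \<gamma>\<close> would meet the conditions of \<open>penalty_psd\<close>: its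
  tail is diagonal, positive below \<open>q\<close>, and its columns from \<open>q\<close> on
  vanish. A very negative \<open>x1\<close> would then make it semidefinite.\<close>

lemma gap_imp_corner_nonzero:
  assumes A1: "head_diag n p A1" and A2: "sym_mat n A2" and c2: "c2 > 0"
    and gap: "has_gap n (A1, A2, Ir0 n r, 0, c2)"
    and pr: "p \<le> r" "r \<le> q" "q \<le> n"
    and off: "\<And>i j. p \<le> i \<Longrightarrow> i < n \<Longrightarrow> p \<le> j \<Longrightarrow> j < n \<Longrightarrow> i \<noteq> j \<Longrightarrow> A2 $$ (i, j) = 0"
    and neg: "\<And>j. r \<le> j \<Longrightarrow> j < q \<Longrightarrow> A2 $$ (j, j) < 0"
    and zero: "\<And>j. q \<le> j \<Longrightarrow> j < n \<Longrightarrow> A2 $$ (j, j) = 0"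
  shows "\<exists>i<p. \<exists>j. q \<le> j \<and> j < n \<and> A2 $$ (i, j) \<noteq> 0"
proof (rule ccontr)
  assume "\<not> ?thesis"
  then have M0: "A2 $$ (i, j) = 0" if "i < p" "q \<le> j" "j < n" for i j using that by blast
  have sB: "sym_mat n (Ir0 n r)" using psd_Ir0[of n r] by (simp add: psd_def)
  note s = head_diagD(1)[OF A1] A2 sB
  note c = s[THEN sym_matD(1)]
  obtain \<alpha> \<beta> where ab: "0 \<le> \<alpha>" "\<alpha> < \<beta>" and
    P: "\<And>x1 x2. primal_feasible n A1 A2 (Ir0 n r) x1 x2 \<Longrightarrow> c2 * x2 \<le> \<alpha>" and
    D: "\<And>w. (\<And>k. k < p \<Longrightarrow> w k = 0) \<Longrightarrow> \<beta> * qf n A2 w w \<le> c2 * qf n (Ir0 n r) w w"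
    using gap_bounds[OF A1 A2 c2 gap] by metis
  define \<gamma> where "\<gamma> = (\<alpha> + \<beta>) / 2"
  have g: "\<alpha> < \<gamma>" "\<gamma> < \<beta>" "0 < \<gamma>" using ab by (auto simp: \<gamma>_def)
  define t where "t = \<gamma> / c2"
  have t: "t > 0" "c2 * t = \<gamma>" using g c2 by (auto simp: t_def)
  let ?S = "slack A1 A2 (Ir0 n r) 0 t"
  have Sij: "?S $$ (i, j) = Ir0 n r $$ (i, j) - t * A2 $$ (i, j)" if "i < n" "j < n" for i j
    using slack_index[OF c that] by simp
  obtain K where K: "\<And>v. 0 \<le> qf n ?S v v + K * qf n A1 v v"
  proof (rule penalty_psd[OF slack_sym[OF s] A1])
    fix i j assume ij: "p \<le> i" "i < n" "p \<le> j" "j < n" "i \<noteq> j"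
    then show "?S $$ (i, j) = 0" by (simp add: Sij off Ir0_index)
  next
    fix j assume j: "p \<le> j" "j < n"
    consider "j < r" | "r \<le> j" "j < q" | "q \<le> j" by linarith
    then show "0 < ?S $$ (j, j) \<or> (\<forall>i<n. ?S $$ (i, j) = 0)"
    proof cases
      case 1
      have "\<beta> * A2 $$ (j, j) \<le> c2"
        using D[of "unit j"] 1 j by (simp add: qf_unit Ir0_index unit_def[of j])
      \<comment> \<open>Taking \<open>\<gamma>\<close> below \<open>\<beta>\<close> turns the weak
        bound into the strict one needed for a positive pivot.\<close>
      then have "\<gamma> * A2 $$ (j, j) < c2"
      proof (cases "A2 $$ (j, j) > 0")
        case True
        then have "\<gamma> * A2 $$ (j, j) < \<beta> * A2 $$ (j, j)" using g by simp
        then show ?thesis using \<open>\<beta> * A2 $$ (j, j) \<le> c2\<close> by simp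
      next
        case False
        then have "\<gamma> * A2 $$ (j, j) \<le> 0" using g by (simp add: mult_le_0_iff)
        then show ?thesis using c2 by simp
      qed
      then have "t * A2 $$ (j, j) < 1" using c2 by (simp add: t_def field_simps)
      then show ?thesis using 1 j by (simp add: Sij Ir0_index)
    next
      case 2
      then show ?thesis using neg[of j] t j by (simp add: Sij Ir0_index mult_pos_neg)
    next
      case 3
      \<comment> \<open>Only here the assumption that the corner vanishes enters: without it the
        column would be nonzero in the first \<open>p\<close> rows.\<close>
      have "A2 $$ (i, j) = 0" if "i < n" for i
        using that 3 j M0[of i j] off[of i j] zero[of j] by (cases "i < p"; cases "i = j") auto
      then show ?thesis using 3 j pr by (auto simp: Sij Ir0_index)
    qed
  qed (rule that)
  \<comment> \<open>Setting \<open>x1 = -K\<close> adds \<open>K A1\<close> to the slack; the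
    objective value is \<open>c2 * t = \<gamma>\<close>.\<close>
  have "primal_feasible n A1 A2 (Ir0 n r) (- K) t"
    unfolding primal_feasible_iff[OF s] using K by (simp add: qf_slack[OF c] algebra_simps)
  from P[OF this] show False using t g by simp
qed

section \<open>Reduction to the normal form\<close>

lemma reformulation_trans: "reformulation n s t \<Longrightarrow> reformulation n t u \<Longrightarrow> reformulation n s u"
  unfolding reformulation_def by (rule rtranclp_trans)

lemma reformulation_step: "reform_step n s t \<Longrightarrow> reformulation n s t"
  unfolding reformulation_def by (rule r_into_rtranclp)

lemma reformulation_mcong:
  assumes "T \<in> carrier_mat n n" "invertible_mat T"
  shows "reformulation n (A1, A2, B, c1, c2) (mcong T A1, mcong T A2, mcong T B, c1, c2)"
  unfolding mcong_def using assms by (intro reformulation_step reform_step.op4)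

text \<open>Both \<open>x = 0\<close> and \<open>Y = 0\<close> are feasible with value 0. This
  excludes a vanishing second coefficient once the first has been made 0.\<close>

lemma not_has_gap_zero_objective:
  assumes "sym_mat n A1" "sym_mat n A2" "psd n B"
  shows "\<not> has_gap n (A1, A2, B, 0, 0)"
proof
  have sB: "sym_mat n B" using assms(3) by (simp add: psd_def)
  note s = assms(1,2) sB
  assume "has_gap n (A1, A2, B, 0, 0)"
  then obtain \<alpha> \<beta> where ab: "\<alpha> < \<beta>"
    and P: "\<And>x1 x2. primal_feasible n A1 A2 B x1 x2 \<Longrightarrow> 0 * x1 + 0 * x2 \<le> \<alpha>"
    and D: "\<And>Y. psd n Y \<Longrightarrow> mat_inner n A1 Y = 0 \<Longrightarrow> mat_inner n A2 Y = 0 \<Longrightarrow> \<beta> \<le> mat_inner n B Y"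
    by (rule has_gapE) (rule that)
  have "0 \<le> \<alpha>" using P[of 0 0] assms(3) by (simp add: primal_feasible_iff[OF s] psd_iff_qf)
  moreover have "\<beta> \<le> 0"
    using D[OF psd_rank_one[of 0 n "unit 0"]] by (simp add: mat_inner_rank_one s[THEN sym_matD(1)])
  ultimately show False using ab by simp
qed

text \<open>Orthogonality of \<open>d\<close> and \<open>c\<close> makes the new first coefficient
  0. The second cannot vanish as well, since the gap persists, so its sign can be
  normalized.\<close>

lemma reformulate_objective:
  assumes s: "sym_mat n A1" "sym_mat n A2" and B: "psd n B"
    and gap: "has_gap n (A1, A2, B, c1, c2)"
    and d1: "d1 \<noteq> 0" and d: "d1 * c1 + d2 * c2 = 0"
  shows "\<exists>A2' c2'. reformulation n (A1, A2, B, c1, c2) ((- d1) \<cdot>\<^sub>m A1 + (- d2) \<cdot>\<^sub>m A2, A2', B, 0, c2') \<and>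
    c2' > 0"
proof -
  let ?A = "(- d1) \<cdot>\<^sub>m A1 + (- d2) \<cdot>\<^sub>m A2"
  have sB: "sym_mat n B" using B by (simp add: psd_def)
  have "- d1 * c1 + - d2 * c2 = 0" using d by simp
  then have r1: "reformulation n (A1, A2, B, c1, c2) (?A, A2, B, 0, c2)"
    using reformulation_step[OF reform_step.op3a[of "- d1" n A1 A2 B c1 c2 "- d2"]] d1 by simp
  have "sym_data n (A1, A2, B, c1, c2)" using s sB by (simp add: sym_data_def)
  then have "has_gap n (?A, A2, B, 0, c2)" "sym_mat n ?A"
    using reformulation_has_gap[OF r1] gap by (auto simp: sym_data_def)
  then have "c2 \<noteq> 0" using not_has_gap_zero_objective[of n ?A A2 B] s B by metis
  \<comment> \<open>Multiplication by the sign yields the coefficient \<open>|c2|\<close>; the zero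
    summands come from taking \<open>b = 0\<close> in the operation.\<close>
  then have "reform_step n (?A, A2, B, 0, c2)
      (?A, sgn c2 \<cdot>\<^sub>m A2 + 0 \<cdot>\<^sub>m ?A, B, 0, sgn c2 * c2 + 0 * 0)"
    by (intro reform_step.op3b) (simp add: sgn_eq_0_iff)
  then have "reformulation n (A1, A2, B, c1, c2)
      (?A, sgn c2 \<cdot>\<^sub>m A2 + 0 \<cdot>\<^sub>m ?A, B, 0, sgn c2 * c2 + 0 * 0)"
    by (intro reformulation_trans[OF r1] reformulation_step)
  moreover have "sgn c2 * c2 + 0 * 0 > 0" using \<open>c2 \<noteq> 0\<close> by (simp add: sgn_if)
  ultimately show ?thesis by blast
qed

text \<open>The recession direction \<open>d\<close> is itself a feasible point, with slack
  \<open>B + A1'\<close>. Maximality of the rank of \<open>B\<close> then confines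
  \<open>A1'\<close> to the leading block.\<close>

lemma gap_reformulation_psd:
  assumes s: "sym_mat n A1" "sym_mat n A2"
    and st: "standing n A1 A2 B r"
    and gap: "has_gap n (A1, A2, B, c1, c2)"
  obtains A1' A2' c2' where
    "reformulation n (A1, A2, B, c1, c2) (A1', A2', Ir0 n r, 0, c2')" "c2' > 0"
    "psd n A1'" "\<And>i j. i < n \<Longrightarrow> j < n \<Longrightarrow> r \<le> i \<or> r \<le> j \<Longrightarrow> A1' $$ (i, j) = 0"
proof -
  have B: "B = Ir0 n r" and r: "r < n"
    and rank: "\<And>x1 x2. primal_feasible n A1 A2 B x1 x2 \<Longrightarrow> mrank n (slack A1 A2 B x1 x2) \<le> mrank n B"
    using st by (auto simp: standing_def)
  have pB: "psd n B" by (simp add: B psd_Ir0)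
  then have sB: "sym_mat n B" by (simp add: psd_def)
  note c = s[THEN sym_matD(1)] sB[THEN sym_matD(1)]
  obtain d1 d2 where d: "d1 \<noteq> 0 \<or> d2 \<noteq> 0" "d1 * c1 + d2 * c2 = 0"
    "\<And>v. d1 * qf n A1 v v + d2 * qf n A2 v v \<le> 0"
    using gap_recession_direction[OF s pB gap] by blast
  let ?A = "(- d1) \<cdot>\<^sub>m A1 + (- d2) \<cdot>\<^sub>m A2"
  have sA: "sym_mat n ?A" using s by (intro sym_mat_plus sym_mat_smult)
  have pA: "psd n ?A"
    using d(3) sA c by (simp add: psd_iff_qf qf_plus_mat qf_smult_mat) (smt (verit))
  have e: "slack A1 A2 B d1 d2 = B + ?A"
    using c by (intro eq_matI) (auto simp: slack_def)
  have "primal_feasible n A1 A2 B d1 d2"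
    unfolding primal_feasible_def e by (rule psd_plus[OF pB pA])
  then have "mrank n (Ir0 n r + ?A) \<le> mrank n (Ir0 n r)"
    using rank unfolding B[symmetric] e[symmetric] by blast
  then have z: "?A $$ (i, j) = 0" if "i < n" "r \<le> j" "j < n" for i j
    using psd_max_rank_zero_block[OF pA _ _ that] r by simp
  have zero: "?A $$ (i, j) = 0" if "i < n" "j < n" "r \<le> i \<or> r \<le> j" for i j
    using that z[of i j] z[of j i] sym_matD(4)[OF sA, of i j] by metis
  have "\<exists>A2' c2'. reformulation n (A1, A2, B, c1, c2) (?A, A2', B, 0, c2') \<and> c2' > 0"
  proof (cases "d1 = 0")
    case False
    then show ?thesis using reformulate_objective[OF s pB gap _ d(2)] by blast
  next
    case True
    \<comment> \<open>When \<open>d1 = 0\<close> the matrix \<open>A1\<close> cannot be replaced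
      directly; after the exchange the other coefficient is nonzero and the combination is the same
      matrix.\<close>
    have sw: "reform_step n (A1, A2, B, c1, c2) (A2, A1, B, c2, c1)" by (rule reform_step.op2)
    have gap': "has_gap n (A2, A1, B, c2, c1)"
      using reform_step_has_gap[OF sw _ gap] s sB by (simp add: sym_data_def)
    have "(- d2) \<cdot>\<^sub>m A2 + (- d1) \<cdot>\<^sub>m A1 = ?A"
      using c by (intro eq_matI) auto
    moreover have "d2 * c2 + d1 * c1 = 0" using d(2) by simp
    ultimately show ?thesis
      using reformulate_objective[OF s(2,1) pB gap', of d2 d1] True d(1)
        reformulation_trans[OF reformulation_step[OF sw]] by metis
  qed
  then show ?thesis using that pA zero unfolding B by blast
qed

section \<open>Elimination by block triangular congruences\<close>

lemma det_nonzero_invertible: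
  fixes A :: "real mat"
  assumes "A \<in> carrier_mat n n" "det A \<noteq> 0"
  shows "invertible_mat A"
proof -
  from det_non_zero_imp_unit[OF assms, of "()"]
  obtain U where "U \<in> carrier_mat n n" "A * U = 1\<^sub>m n" "U * A = 1\<^sub>m n"
    by (auto simp: Units_def ring_mat_def)
  then show ?thesis using assms(1) by (auto simp: invertible_mat_def inverts_mat_def)
qed

text \<open>Only the first \<open>r\<close> rows of \<open>T\<close> meet nonzero entries of
  \<open>C\<close>, and there \<open>T\<close> agrees with the identity.\<close>

lemma mcong_leading_block:
  assumes T: "T \<in> carrier_mat n n" and C: "C \<in> carrier_mat n n"
    and lead: "\<And>k j. k < r \<Longrightarrow> k < n \<Longrightarrow> j < n \<Longrightarrow> T $$ (k, j) = unit j k"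
    and z: "\<And>i j. i < n \<Longrightarrow> j < n \<Longrightarrow> r \<le> i \<or> r \<le> j \<Longrightarrow> C $$ (i, j) = 0"
  shows "mcong T C = C"
proof (rule eq_matI)
  fix i j assume "i < dim_row C" "j < dim_col C"
  then have ij: "i < n" "j < n" using C by auto
  have "mcong T C $$ (i, j) = qf n C (unit i) (unit j)"
    unfolding mcong_index[OF T C ij] qf_def
  proof (intro sum.cong refl)
    fix k l assume "k \<in> {..<n}" "l \<in> {..<n}"
    then show "T $$ (k, i) * C $$ (k, l) * T $$ (l, j) = unit i k * C $$ (k, l) * unit j l"
      using z[of k l] ij by (cases "k < r \<and> l < r") (auto simp: lead)
  qed
  then show "mcong T C $$ (i, j) = C $$ (i, j)" using ij by (simp add: qf_unit)
qed (use mcong_carrier[OF T C] C in auto)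

text \<open>A Schur complement step: the negative pivots \<open>A(k,k)\<close>, \<open>r \<le> k < q\<close>, clear the block to
  the left of them.\<close>

lemma eliminate_negative_block:
  assumes A: "sym_mat n A" and q: "r \<le> q" "q \<le> n"
    and diag: "\<And>i j. r \<le> i \<Longrightarrow> i < n \<Longrightarrow> r \<le> j \<Longrightarrow> j < n \<Longrightarrow> i \<noteq> j \<Longrightarrow> A $$ (i, j) = 0"
    and neg: "\<And>j. r \<le> j \<Longrightarrow> j < q \<Longrightarrow> A $$ (j, j) < 0"
    and zero: "\<And>j. q \<le> j \<Longrightarrow> j < n \<Longrightarrow> A $$ (j, j) = 0"
    and col: "\<And>i j. p \<le> i \<Longrightarrow> i < r \<Longrightarrow> q \<le> j \<Longrightarrow> j < n \<Longrightarrow> A $$ (i, j) = 0"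
  obtains T where "T \<in> carrier_mat n n" "invertible_mat T"
    "\<And>k j. k < r \<Longrightarrow> k < n \<Longrightarrow> j < n \<Longrightarrow> T $$ (k, j) = unit j k"
    "\<And>i j. r \<le> i \<Longrightarrow> i < n \<Longrightarrow> r \<le> j \<Longrightarrow> j < n \<Longrightarrow>
      mcong T A $$ (i, j) = (if i = j \<and> i < q then - 1 else 0)"
    "\<And>i j. p \<le> i \<Longrightarrow> i < r \<Longrightarrow> r \<le> j \<Longrightarrow> j < n \<Longrightarrow> mcong T A $$ (i, j) = 0"
proof -
  note cA = sym_matD(1)[OF A]
  \<comment> \<open>Scales the negative pivots to \<open>-1\<close>.\<close>
  define \<sigma> where "\<sigma> j = (if r \<le> j \<and> j < q then 1 / sqrt (- A $$ (j, j)) else 1)" for j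
  \<comment> \<open>The elimination multiplier, placed in row \<open>k\<close> of column
    \<open>i\<close>. As \<open>i < r \<le> k\<close>, it lies below the diagonal, so
    \<open>T\<close> is lower triangular with positive diagonal.\<close>
  define \<tau> where "\<tau> i k = (if p \<le> i \<and> i < r \<and> r \<le> k \<and> k < q then - A $$ (i, k) / A $$ (k, k) else 0)" for i k
  define T where "T = mat n n (\<lambda>(k, j). \<sigma> j * unit j k + \<tau> j k)"
  have cT: "T \<in> carrier_mat n n" by (simp add: T_def)
  have \<sigma>: "\<sigma> j > 0" for j using neg[of j] by (simp add: \<sigma>_def)
  have T0: "T $$ (i, j) = 0" if "i < j" "j < n" for i j
    using that by (simp add: T_def unit_def \<tau>_def)
  have Td: "T $$ (i, i) = \<sigma> i" if "i < n" for i
    using that by (auto simp: T_def unit_def \<tau>_def)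
  have "det T = prod_list (diag_mat T)"
    by (rule det_lower_triangular[OF T0 cT])
  also have "\<dots> = (\<Prod>i = 0..<n. \<sigma> i)"
    using cT Td by (simp add: prod_list_diag_prod)
  finally have "det T \<noteq> 0" using \<sigma> by (simp add: less_imp_neq[symmetric])
  then have inv: "invertible_mat T" by (rule det_nonzero_invertible[OF cT])
  have tail: "T $$ (k, j) = \<sigma> j * unit j k" if "r \<le> j" "j < n" "k < n" for j k
    using that by (simp add: T_def \<tau>_def)
  \<comment> \<open>Column \<open>j\<close> of \<open>T\<close> is a multiple of \<open>e_j\<close>
    for \<open>j \<ge> r\<close>, so only row \<open>j\<close> of \<open>A\<close> is
    involved.\<close>
  have col_eq: "mcong T A $$ (i, j) = \<sigma> j * (\<Sum>k<n. A $$ (j, k) * T $$ (k, i))"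
    if "i < n" "r \<le> j" "j < n" for i j
  proof -
    have "mcong T A $$ (i, j) = qf n A (\<lambda>k. T $$ (k, i)) (\<lambda>k. \<sigma> j * unit j k)"
      unfolding mcong_index[OF cT cA that(1,3)] using that tail by (intro qf_cong) auto
    then show ?thesis
      using that by (simp add: qf_scale_right qf_commute[OF A, of _ "unit j"] qf_unit_left)
  qed
  show ?thesis
  proof (rule that[OF cT inv])
    show "T $$ (k, j) = unit j k" if "k < r" "k < n" "j < n" for k j
      using that by (simp add: T_def \<tau>_def \<sigma>_def unit_def)
  next
    fix i j assume ij: "r \<le> i" "i < n" "r \<le> j" "j < n"
    have "(\<Sum>k<n. A $$ (j, k) * T $$ (k, i)) = (\<Sum>k<n. (\<sigma> i * A $$ (j, k)) * unit i k)"
      using ij tail by (intro sum.cong) auto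
    also have "\<dots> = \<sigma> i * A $$ (j, i)" using ij by (simp add: sum_unit_right)
    finally have e: "mcong T A $$ (i, j) = \<sigma> j * (\<sigma> i * A $$ (j, i))" using ij by (simp add: col_eq)
    show "mcong T A $$ (i, j) = (if i = j \<and> i < q then - 1 else 0)"
    proof (cases "i = j \<and> i < q")
      case True
      then have "A $$ (i, i) < 0" using ij neg by simp
      then show ?thesis using True ij e by (simp add: \<sigma>_def field_simps)
    next
      case False
      then have "A $$ (j, i) = 0" using ij diag[of j i] zero[of j] by (cases "i = j") auto
      then show ?thesis using False e by auto
    qed
  next
    fix i j assume ij: "p \<le> i" "i < r" "r \<le> j" "j < n"
    have "(\<Sum>k<n. A $$ (j, k) * T $$ (k, i)) = (\<Sum>k<n. A $$ (j, k) * unit i k + (A $$ (j, k) * \<tau> i k) * unit j k)"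
    proof (rule sum.cong[OF refl])
      fix k assume k: "k \<in> {..<n}"
      have "A $$ (j, k) * \<tau> i k = A $$ (j, k) * \<tau> i k * unit j k"
        using k ij diag[of j k] by (cases "k = j") (auto simp: unit_def \<tau>_def)
      then show "A $$ (j, k) * T $$ (k, i) = A $$ (j, k) * unit i k + (A $$ (j, k) * \<tau> i k) * unit j k"
        using k ij q by (simp add: T_def \<sigma>_def algebra_simps)
    qed
    also have "\<dots> = A $$ (j, i) + A $$ (j, j) * \<tau> i j"
      using ij q by (simp add: sum.distrib sum_unit_right)
    \<comment> \<open>For \<open>j < q\<close> the multiplier cancels the entry; for
      \<open>j \<ge> q\<close> it is 0 and the entry already vanishes by \<open>col\<close>.\<close>
    also have "\<dots> = 0"
    proof (cases "j < q")
      case True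
      then show ?thesis using ij q neg[of j] sym_matD(4)[OF A, of i j] by (simp add: \<tau>_def)
    next
      case False
      then show ?thesis using ij q col[of i j] sym_matD(4)[OF A, of i j] by (simp add: \<tau>_def)
    qed
    finally show "mcong T A $$ (i, j) = 0" using ij q by (simp add: col_eq)
  qed
qed

text \<open>Four congruences in turn: \<open>T\<close> diagonalizes \<open>A1\<close> with its
  positive entries first, \<open>U\<close> diagonalizes the lower right block of \<open>A2\<close>
  with negative entries first, \<open>V\<close> turns these into \<open>-1\<close> and clears the
  entries coupling them to the second block, and \<open>W\<close> diagonalizes that block of
  \<open>A2\<close>. Each fixes \<open>B\<close>, and the last three fix the diagonalized
  \<open>A1\<close>.\<close>

lemma gap_imp_normal_form:
  assumes A1: "psd n A1" and A2: "sym_mat n A2" and c2: "c2 > 0" and r: "r \<le> n"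
    and z: "\<And>i j. i < n \<Longrightarrow> j < n \<Longrightarrow> r \<le> i \<or> r \<le> j \<Longrightarrow> A1 $$ (i, j) = 0"
    and gap: "has_gap n (A1, A2, Ir0 n r, 0, c2)"
  shows "\<exists>A1' A2'. reformulation n (A1, A2, Ir0 n r, 0, c2) (A1', A2', Ir0 n r, 0, c2) \<and>
    normal_form n r A1' A2' (Ir0 n r) 0 c2"
proof -
  let ?B = "Ir0 n r"
  have sB: "sym_mat n ?B" using psd_Ir0[of n r] by (simp add: psd_def)
  \<comment> \<open>The gap is carried along with the reformulation because the zero blocks and the
    nonzero corner are deduced from it at intermediate stages.\<close>
  have step: "reformulation n (X, Y, ?B, 0, c2) (mcong T X, mcong T Y, ?B, 0, c2)"
    "has_gap n (X, Y, ?B, 0, c2) \<Longrightarrow> has_gap n (mcong T X, mcong T Y, ?B, 0, c2)"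
    if "T \<in> carrier_mat n n" "invertible_mat T" "mcong T ?B = ?B" "sym_mat n X" "sym_mat n Y" for T X Y
  proof -
    show *: "reformulation n (X, Y, ?B, 0, c2) (mcong T X, mcong T Y, ?B, 0, c2)"
      using reformulation_mcong[OF that(1,2), of X Y ?B 0 c2] that(3) by simp
    show "has_gap n (mcong T X, mcong T Y, ?B, 0, c2)" if "has_gap n (X, Y, ?B, 0, c2)"
      using reformulation_has_gap(2)[OF *] that sB \<open>sym_mat n X\<close> \<open>sym_mat n Y\<close> by (simp add: sym_data_def)
  qed
  have sA1: "sym_mat n A1" using A1 by (simp add: psd_def)

  obtain T p where T: "orth_on n 0 r T" "p \<le> r"
    "\<And>i j. i \<in> {0..<r} \<Longrightarrow> j \<in> {0..<r} \<Longrightarrow> i \<noteq> j \<Longrightarrow> mcong T A1 $$ (i, j) = 0"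
    "\<And>i. i \<in> {0..<r} \<Longrightarrow> 0 < mcong T A1 $$ (i, i) \<longleftrightarrow> i < p"
    using sorted_orth_diagonalization[OF sA1 le0 r, of "\<lambda>x. 0 < x"] by metis
  note cT = orth_onD(1)[OF T(1)] orth_on_invertible[OF T(1)]
  define L where "L = mcong T A1"
  define G where "G = mcong T A2"
  have sG: "sym_mat n G" unfolding G_def by (rule mcong_sym[OF cT(1) A2])
  have pL: "psd n L" unfolding L_def by (rule psd_mcong[OF cT(1) A1])
  then have sL: "sym_mat n L" by (simp add: psd_def)
  have TB: "mcong T ?B = ?B"
    by (rule mcong_orth_on_scalar_block[OF T(1), where \<kappa> = 1]) (auto simp: Ir0_index)
  have Lz: "L $$ (i, j) = 0" if "i < n" "j < n" "r \<le> i" for i j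
  proof (cases "j < r")
    case True
    then show ?thesis unfolding L_def
      by (intro mcong_orth_on_mixed_zero[OF T(1) sym_matD(1)[OF sA1]]) (use that z in auto)
  next
    case False
    then show ?thesis using that z unfolding L_def
      by (subst mcong_orth_on_outside[OF T(1) sym_matD(1)[OF sA1]]) auto
  qed
  have L: "head_diag n p L"
    unfolding head_diag_def
  proof (intro conjI allI impI)
    fix i j assume ij: "i < n" "j < n" "i \<noteq> j \<or> p \<le> i"
    consider "r \<le> i" | "r \<le> j" | "i < r" "j < r" "i \<noteq> j" | "i < r" "i = j" "p \<le> i"
      using ij by linarith
    then show "L $$ (i, j) = 0"
    proof cases
      case 1 then show ?thesis using Lz ij by simp
    next
      case 2 then show ?thesis using Lz[of j i] sym_matD(4)[OF sL, of i j] ij by simp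
    next
      case 3 then show ?thesis using T(3)[of i j] by (simp add: L_def)
    next
      \<comment> \<open>The sorting excludes a positive entry, semidefiniteness a negative
        one.\<close>
      case 4 then show ?thesis using T(4)[of i] psd_diag_nonneg[OF pL, of i] ij by (simp add: L_def)
    qed
  next
    show "0 < L $$ (i, i)" if "i < p" for i using T(2) T(4)[of i] that by (simp add: L_def)
  qed (use sL T(2) r in auto)
  have r1: "reformulation n (A1, A2, ?B, 0, c2) (L, G, ?B, 0, c2)"
    and g1: "has_gap n (L, G, ?B, 0, c2)"
    using step[OF cT TB sA1 A2] gap by (simp_all add: L_def G_def)

  obtain U q where U: "orth_on n r n U" "r \<le> q" "q \<le> n"
    "\<And>i j. i \<in> {r..<n} \<Longrightarrow> j \<in> {r..<n} \<Longrightarrow> i \<noteq> j \<Longrightarrow> mcong U G $$ (i, j) = 0"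
    "\<And>i. i \<in> {r..<n} \<Longrightarrow> mcong U G $$ (i, i) < 0 \<longleftrightarrow> i < q"
    using sorted_orth_diagonalization[OF sG r order_refl, of "\<lambda>x. x < 0"] by metis
  note cU = orth_onD(1)[OF U(1)] orth_on_invertible[OF U(1)]
  define H where "H = mcong U G"
  have sH: "sym_mat n H" unfolding H_def by (rule mcong_sym[OF cU(1) sG])
  have UB: "mcong U ?B = ?B"
    by (rule mcong_orth_on_scalar_block[OF U(1), where \<kappa> = 0]) (auto simp: Ir0_index)
  have UL: "mcong U L = L"
    by (rule mcong_orth_on_scalar_block[OF U(1), where \<kappa> = 0])
      (use T(2) head_diagD(3)[OF L] sym_matD(1)[OF sL] in auto)
  have r2: "reformulation n (L, G, ?B, 0, c2) (L, H, ?B, 0, c2)"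
    and g2: "has_gap n (L, H, ?B, 0, c2)"
    using step[OF cU UB sL sG] g1 by (simp_all add: H_def UL)
  have Hneg: "H $$ (j, j) < 0" if "r \<le> j" "j < q" for j
    using U(3) U(5)[of j] that by (simp add: H_def)
  \<comment> \<open>The sorting only says that these entries are nonnegative; the gap excludes
    positive ones.\<close>
  have Hzero: "H $$ (j, j) = 0" if "q \<le> j" "j < n" for j
    using U(2) U(5)[of j] that gap_imp_tail_nonpos(1)[OF L sH c2 g2 T(2), of j] by (simp add: H_def)
  have Hcol: "H $$ (i, j) = 0" if "p \<le> i" "i < r" "q \<le> j" "j < n" for i j
    using gap_imp_tail_nonpos(2)[OF L sH c2 g2 T(2), of j i] Hzero[of j] that U(2) by simp

  obtain V where V: "V \<in> carrier_mat n n" "invertible_mat V"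
    "\<And>k j. k < r \<Longrightarrow> k < n \<Longrightarrow> j < n \<Longrightarrow> V $$ (k, j) = unit j k"
    "\<And>i j. r \<le> i \<Longrightarrow> i < n \<Longrightarrow> r \<le> j \<Longrightarrow> j < n \<Longrightarrow>
      mcong V H $$ (i, j) = (if i = j \<and> i < q then - 1 else 0)"
    "\<And>i j. p \<le> i \<Longrightarrow> i < r \<Longrightarrow> r \<le> j \<Longrightarrow> j < n \<Longrightarrow> mcong V H $$ (i, j) = 0"
  proof (rule eliminate_negative_block[OF sH U(2,3)])
    show "H $$ (i, j) = 0" if "r \<le> i" "i < n" "r \<le> j" "j < n" "i \<noteq> j" for i j
      using U(4)[of i j] that by (simp add: H_def)
  qed (use Hneg Hzero Hcol that in blast)+
  define N where "N = mcong V H"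
  have sN: "sym_mat n N" unfolding N_def by (rule mcong_sym[OF V(1) sH])
  have VB: "mcong V ?B = ?B"
    by (rule mcong_leading_block[OF V(1) _ V(3)]) (auto simp: Ir0_index)
  have VL: "mcong V L = L"
    by (rule mcong_leading_block[OF V(1) sym_matD(1)[OF sL] V(3)])
      (use T(2) head_diagD(3)[OF L] in auto)
  have r3: "reformulation n (L, H, ?B, 0, c2) (L, N, ?B, 0, c2)"
    and g3: "has_gap n (L, N, ?B, 0, c2)"
    using step[OF V(1,2) VB sL sH] g2 by (simp_all add: N_def VL)

  \<comment> \<open>This comes last because the elimination changes the second block.
    \<open>W\<close> acts only inside \<open>{p..<r}\<close>, where \<open>L\<close> vanishes and
    the coupling to later blocks is already zero, so earlier gains survive.\<close>
  from orth_diagonalization[OF sN r, of p] obtain W where W: "orth_on n p r W"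
    "\<And>i j. i \<in> {p..<r} \<Longrightarrow> j \<in> {p..<r} \<Longrightarrow> i \<noteq> j \<Longrightarrow> mcong W N $$ (i, j) = 0"
    by blast
  note cW = orth_onD(1)[OF W(1)] orth_on_invertible[OF W(1)]
  define R where "R = mcong W N"
  have sR: "sym_mat n R" unfolding R_def by (rule mcong_sym[OF cW(1) sN])
  have WB: "mcong W ?B = ?B"
    by (rule mcong_orth_on_scalar_block[OF W(1), where \<kappa> = 1]) (auto simp: Ir0_index)
  have WL: "mcong W L = L"
    by (rule mcong_orth_on_scalar_block[OF W(1), where \<kappa> = 0])
      (use head_diagD(3)[OF L] sym_matD(1)[OF sL] in auto)
  have r4: "reformulation n (L, N, ?B, 0, c2) (L, R, ?B, 0, c2)"
    and g4: "has_gap n (L, R, ?B, 0, c2)"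
    using step[OF cW WB sL sN] g3 by (simp_all add: R_def WL)
  have R33: "R $$ (i, j) = (if i = j \<and> i < q then - 1 else 0)"
    if "r \<le> i" "i < n" "r \<le> j" "j < n" for i j
    unfolding R_def using that V(4)[of i j]
    by (subst mcong_orth_on_outside[OF W(1) sym_matD(1)[OF sN]]) (auto simp: N_def)
  have R32: "R $$ (j, i) = 0" if "p \<le> i" "i < r" "r \<le> j" "j < n" for i j
    unfolding R_def
  proof (rule mcong_orth_on_mixed_zero[OF W(1) sym_matD(1)[OF sN]])
    fix k assume "k < n" "k \<in> {p..<r}"
    then show "N $$ (j, k) = 0"
      using V(5)[of k j] that sym_matD(4)[OF sN, of j k] by (simp add: N_def)
  qed (use that in auto)
  have R23: "R $$ (i, j) = 0" if "p \<le> i" "i < r" "r \<le> j" "j < n" for i j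
    using R32[OF that] sym_matD(4)[OF sR, of i j] that by simp
  have R22: "R $$ (i, j) = 0" if "p \<le> i" "i < r" "p \<le> j" "j < r" "i \<noteq> j" for i j
    using W(2)[of i j] that by (simp add: R_def)
  have Roff: "R $$ (i, j) = 0" if "p \<le> i" "i < n" "p \<le> j" "j < n" "i \<noteq> j" for i j
    using that R22[of i j] R23[of i j] R32[of j i] R33[of i j]
    by (cases "i < r"; cases "j < r") auto
  have M: "\<exists>i<p. \<exists>j. q \<le> j \<and> j < n \<and> R $$ (i, j) \<noteq> 0"
    by (rule gap_imp_corner_nonzero[OF L sR c2 g4 T(2) U(2,3) Roff])
      (use R33 U(2,3) T(2) in auto)
  have "normal_form n r L R ?B 0 c2"
    unfolding normal_form_def
  \<comment> \<open>Here \<open>s\<close> counts the negative pivots, so that \<open>r + s\<close>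
    equals \<open>q\<close>; the natural subtraction is exact as \<open>r \<le> q\<close>.\<close>
  proof (intro conjI; (rule exI[of _ p], rule exI[of _ "q - r"], intro conjI)?)
    have q: "r + (q - r) = q" using U(2) by simp
    show "r + (q - r) \<le> n" using q U(3) by simp
    show "\<exists>i<p. \<exists>j. r + (q - r) \<le> j \<and> j < n \<and> R $$ (i, j) \<noteq> 0" using M q by simp
    show "\<forall>i j. r \<le> i \<and> i < r + (q - r) \<and> r \<le> j \<and> j < r + (q - r) \<longrightarrow>
        R $$ (i, j) = (if i = j then - 1 else 0)"
      using R33 U(3) q by auto
    show "\<forall>i j. r \<le> i \<and> i < n \<and> r + (q - r) \<le> j \<and> j < n \<longrightarrow> R $$ (i, j) = 0"
      using R33 U(2) q by auto
  qed (use c2 sL sR T(2) head_diagD(3,4)[OF L] R22 R23 in auto)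
  moreover have "reformulation n (A1, A2, ?B, 0, c2) (L, R, ?B, 0, c2)"
    by (rule reformulation_trans[OF reformulation_trans[OF r1 r2] reformulation_trans[OF r3 r4]])
  ultimately show ?thesis by blast
qed

theorem theorem1:
  fixes n r :: nat and A1 A2 B :: "real mat" and c1 c2 :: real
  assumes "sym_mat n A1" and "sym_mat n A2" and "sym_mat n B"
    and "standing n A1 A2 B r"
  shows "valP n A1 A2 B c1 c2 < valD n A1 A2 B c1 c2 \<longleftrightarrow>
    (\<exists>A1' A2' B' c1' c2'. reformulation n (A1, A2, B, c1, c2) (A1', A2', B', c1', c2') \<and>
        normal_form n r A1' A2' B' c1' c2')"
proof -
  have sd: "sym_data n (A1, A2, B, c1, c2)" using assms by (simp add: sym_data_def)
  show ?thesis
    unfolding valP_less_valD_iff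
  proof
    assume gap: "has_gap n (A1, A2, B, c1, c2)"
    obtain A1' A2' c2' where ref: "reformulation n (A1, A2, B, c1, c2) (A1', A2', Ir0 n r, 0, c2')"
      and c2': "c2' > 0" and A1': "psd n A1'"
      and z: "\<And>i j. i < n \<Longrightarrow> j < n \<Longrightarrow> r \<le> i \<or> r \<le> j \<Longrightarrow> A1' $$ (i, j) = 0"
      using gap_reformulation_psd[OF assms(1,2,4) gap] by metis
    have "sym_mat n A2'" and gap': "has_gap n (A1', A2', Ir0 n r, 0, c2')"
      using reformulation_has_gap[OF ref sd] gap by (auto simp: sym_data_def)
    moreover have "r \<le> n" using assms(4) by (simp add: standing_def)
    ultimately obtain A1'' A2'' where
      "reformulation n (A1', A2', Ir0 n r, 0, c2') (A1'', A2'', Ir0 n r, 0, c2')"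
      "normal_form n r A1'' A2'' (Ir0 n r) 0 c2'"
      using gap_imp_normal_form[OF A1' _ c2' _ z] by blast
    then show "\<exists>A1' A2' B' c1' c2'. reformulation n (A1, A2, B, c1, c2) (A1', A2', B', c1', c2') \<and>
        normal_form n r A1' A2' B' c1' c2'"
      using reformulation_trans[OF ref] by blast
  next
    assume "\<exists>A1' A2' B' c1' c2'. reformulation n (A1, A2, B, c1, c2) (A1', A2', B', c1', c2') \<and>
        normal_form n r A1' A2' B' c1' c2'"
    then show "has_gap n (A1, A2, B, c1, c2)"
      using normal_form_has_gap reformulation_has_gap(2)[OF _ sd] by blast
  qed
qed

end
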